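(* Fix $R_p,R_I,r_p,r_I>0$. Let $p_c$ denote the upper critical probability of the dependent site-percolation model $\mathcal{L}$, and define $$I(r,R_p,r_I)=2\int_0^r t\,\frac{S_I(t,R_p,r_I)}{\pi R_p^2}\,\mathrm{d}t,$$ where $S_I(t,R_p,r_I)$ is the common area of two disks with radii $R_p$ and $r_I$ whose centers are at distance $t$. Then the secondary network $\mathcal{G}(\lambda_S,\lambda_{PT})$ is connected if $$\left[1-\exp\left(-\frac{\lambda_S r_p^2}{8}\right)\right]\exp\left\{-\lambda_{PT}\,\pi\left[R_I^2+r_I^2-I(R_I,R_p,r_I)\right]\right\}>p_c.$$
   Context: Heterogeneous network model in $\mathbb{R}^2$ with fixed parameters $R_p,R_I,r_p,r_I>0$ and densities $\lambda_S>0$, $\lambda_{PT}\ge 0$. Primary transmitters form a homogeneous Poisson point process of density $\lambda_{PT}$; each primary transmitter has one primary receiver, located uniformly at random in the disk of radius $R_p$ centered at the transmitter, independently for different transmitters. Secondary users form a homogeneous Poisson point process of density $\lambda_S$, independent of the primary transmitters and receivers. A secondary user sees an opportunity if there is no primary transmitter within distance $R_I$ of it and no primary receiver within distance $r_I$ of it. $\mathcal{G}(\lambda_S,\lambda_{PT})$ is the undirected random graph whose vertices are the secondary users, with an edge between two distinct secondary users $A,B$ if and only if their distance is at most $r_p$ and both $A$ and $B$ see an opportunity. $\mathcal{G}(\lambda_S,\lambda_{PT})$ is called connected if almost surely it contains an infinite connected component. Site-percolation model $\mathcal{L}$: partition $\mathbb{R}^2$ into squares of side length $d=\frac{r_p}{2\sqrt2}$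 in the usual grid fashion, and place a site at the center of each square (the origin being a site). Two sites are neighbors if their squares share at least one common point, so each site has eight neighbors. A site is occupied if its square contains at least one secondary user that sees an opportunity. An occupied component is a connected component consisting of occupied sites. The occupied probability $p$ is the probability that a given site is occupied. The upper critical probability $p_c$ of $\mathcal{L}$ (for the fixed $R_p,R_I,r_p,r_I$) is the minimum value $p^*$ such that whenever the occupied probability satisfies $p>p^*$, an infinite occupied component containing the origin exists in $\mathcal{L}$ with positive probability (the implication being over all density pairs $(\lambda_S,\lambda_{PT})$). *)

theory Defs
  imports "HOL-Probability.Probability" "HOL-Library.Extended_Nat"
begin

section \<open>Poisson point processes in the plane\<close>

type_synonym plane = "real ^ 2"

text \<open>
  A random point configuration is given by a measurable enumeration \<open>(N, X)\<close>: in outcome \<open>\<omega>\<close> its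
  points are \<open>X i \<omega>\<close> for the indices \<open>i < N \<omega>\<close>, where \<open>N \<omega>\<close> may be finite or infinite. The values
  \<open>X i \<omega>\<close> at indices \<open>i \<ge> N \<omega>\<close> carry no meaning.
\<close>

type_synonym 'w point_process = "('w \<Rightarrow> enat) \<times> (nat \<Rightarrow> 'w \<Rightarrow> plane)"

definition indices :: "'w point_process \<Rightarrow> 'w \<Rightarrow> nat set" where
  "indices P \<omega> = {i. enat i < fst P \<omega>}"

definition points :: "'w point_process \<Rightarrow> 'w \<Rightarrow> plane set" where
  "points P \<omega> = (\<lambda>i. snd P i \<omega>) ` indices P \<omega>"

definition num_points :: "'w point_process \<Rightarrow> plane set \<Rightarrow> 'w \<Rightarrow> nat" where
  "num_points P A \<omega> = card {i \<in> indices P \<omega>. snd P i \<omega> \<in> A}"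

definition enumeration_space :: "(enat \<times> (nat \<Rightarrow> plane)) measure" where
  "enumeration_space = count_space UNIV \<Otimes>\<^sub>M (\<Pi>\<^sub>M i\<in>UNIV. borel)"

definition enumeration :: "'w point_process \<Rightarrow> 'w \<Rightarrow> enat \<times> (nat \<Rightarrow> plane)" where
  "enumeration P \<omega> = (fst P \<omega>, \<lambda>i. snd P i \<omega>)"

text \<open>
  The Poisson weights are written out because \<^const>\<open>poisson_pmf\<close> is only specified for positive
  rates, whereas the mean \<open>l * measure lborel A\<close> may be \<open>0\<close> here; with \<open>0 ^ 0 = 1\<close> the formula then
  gives the point mass at \<open>0\<close>. Points are counted with multiplicity; the conditions force the
  points to be pairwise distinct almost surely.
\<close>

definition homogeneous_PPP :: "'w measure \<Rightarrow> real \<Rightarrow> 'w point_process \<Rightarrow> bool" where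
  "homogeneous_PPP M l P \<longleftrightarrow>
     enumeration P \<in> measurable M enumeration_space \<and>
     (AE \<omega> in M. \<forall>A. bounded A \<longrightarrow> finite {i \<in> indices P \<omega>. snd P i \<omega> \<in> A}) \<and>
     (\<forall>A k. A \<in> sets borel \<and> bounded A \<longrightarrow>
        measure M {\<omega> \<in> space M. num_points P A \<omega> = k} =
          (l * measure lborel A) ^ k / fact k * exp (- (l * measure lborel A))) \<and>
     (\<forall>A :: nat \<Rightarrow> plane set.
        (\<forall>n. A n \<in> sets borel \<and> bounded (A n)) \<and> disjoint_family A \<longrightarrow>
        prob_space.indep_vars M (\<lambda>_. count_space UNIV) (\<lambda>n. num_points P (A n)) UNIV)"

text \<open>
  Independence of two random elements with values in possibly different types
  (the library's \<open>indep_var\<close> requires a common value type).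
\<close>

definition indep_elements ::
  "'w measure \<Rightarrow> 'a measure \<Rightarrow> ('w \<Rightarrow> 'a) \<Rightarrow> 'b measure \<Rightarrow> ('w \<Rightarrow> 'b) \<Rightarrow> bool" where
  "indep_elements M A X B Y \<longleftrightarrow>
     X \<in> measurable M A \<and> Y \<in> measurable M B \<and>
     prob_space.indep_set M (sets (vimage_algebra (space M) X A)) (sets (vimage_algebra (space M) Y B))"

section \<open>The heterogeneous network\<close>

text \<open>The receiver of the transmitter with index \<open>i\<close> is at \<open>rx net i \<omega>\<close>.\<close>

record 'w network =
  prob :: "'w measure"
  secondary :: "'w point_process"
  primary_tx :: "'w point_process"
  rx :: "nat \<Rightarrow> 'w \<Rightarrow> plane"

definition rx_offset :: "'w network \<Rightarrow> nat \<Rightarrow> 'w \<Rightarrow> plane" where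
  "rx_offset net i \<omega> = rx net i \<omega> - snd (primary_tx net) i \<omega>"

definition heterogeneous_network :: "real \<Rightarrow> real \<Rightarrow> real \<Rightarrow> 'w network \<Rightarrow> bool" where
  "heterogeneous_network R_p l_S l_PT net \<longleftrightarrow>
     prob_space (prob net) \<and>
     homogeneous_PPP (prob net) l_S (secondary net) \<and>
     homogeneous_PPP (prob net) l_PT (primary_tx net) \<and>
     (\<forall>i. distr (prob net) borel (rx_offset net i) = uniform_measure lborel (cball 0 R_p)) \<and>
     prob_space.indep_vars (prob net) (\<lambda>_. borel) (rx_offset net) UNIV \<and>
     indep_elements (prob net)
       enumeration_space (enumeration (primary_tx net))
       (\<Pi>\<^sub>M i\<in>UNIV. borel) (\<lambda>\<omega> i. rx_offset net i \<omega>) \<and>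
     indep_elements (prob net)
       enumeration_space (enumeration (secondary net))
       (enumeration_space \<Otimes>\<^sub>M (\<Pi>\<^sub>M i\<in>UNIV. borel))
       (\<lambda>\<omega>. (enumeration (primary_tx net) \<omega>, \<lambda>i. rx net i \<omega>))"

definition sees_opportunity :: "real \<Rightarrow> real \<Rightarrow> 'w network \<Rightarrow> 'w \<Rightarrow> plane \<Rightarrow> bool" where
  "sees_opportunity R_I r_I net \<omega> x \<longleftrightarrow>
     (\<forall>i \<in> indices (primary_tx net) \<omega>.
        \<not> dist x (snd (primary_tx net) i \<omega>) \<le> R_I \<and> \<not> dist x (rx net i \<omega>) \<le> r_I)"

text \<open>
  \<open>in_infinite_component V E x\<close>: \<open>x\<close> is a vertex of the graph with vertex set \<open>V\<close> and adjacency \<open>E\<close>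
  (restricted to \<open>V\<close>), and its connected component is infinite.
\<close>

definition in_infinite_component :: "'v set \<Rightarrow> ('v \<Rightarrow> 'v \<Rightarrow> bool) \<Rightarrow> 'v \<Rightarrow> bool" where
  "in_infinite_component V E x \<longleftrightarrow>
     x \<in> V \<and> infinite {y. (\<lambda>a b. a \<in> V \<and> b \<in> V \<and> E a b)\<^sup>*\<^sup>* x y}"

definition secondary_edge ::
  "real \<Rightarrow> real \<Rightarrow> real \<Rightarrow> 'w network \<Rightarrow> 'w \<Rightarrow> plane \<Rightarrow> plane \<Rightarrow> bool" where
  "secondary_edge R_I r_p r_I net \<omega> a b \<longleftrightarrow>
     a \<noteq> b \<and> dist a b \<le> r_p \<and> sees_opportunity R_I r_I net \<omega> a \<and> sees_opportunity R_I r_I net \<omega> b"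

definition secondary_network_connected :: "real \<Rightarrow> real \<Rightarrow> real \<Rightarrow> 'w network \<Rightarrow> bool" where
  "secondary_network_connected R_I r_p r_I net \<longleftrightarrow>
     (AE \<omega> in prob net. \<exists>x.
        in_infinite_component (points (secondary net) \<omega>) (secondary_edge R_I r_p r_I net \<omega>) x)"

section \<open>The dependent site percolation model\<close>

text \<open>
  Sites are indexed by \<open>(i, j) \<in> \<int>\<^sup>2\<close>; the site \<open>(i, j)\<close> lies at \<open>(d * i, d * j)\<close>. Squares are
  closed, so that squares meeting only in an edge or a corner do share a point.
\<close>

type_synonym site = "int \<times> int"

definition side_length :: "real \<Rightarrow> real" where
  "side_length r_p = r_p / (2 * sqrt 2)"

definition site_center :: "real \<Rightarrow> site \<Rightarrow> plane" where
  "site_center r_p s = side_length r_p *\<^sub>R vector [of_int (fst s), of_int (snd s)]"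

definition square :: "real \<Rightarrow> site \<Rightarrow> plane set" where
  "square r_p s = {x. \<forall>k. \<bar>x $ k - site_center r_p s $ k\<bar> \<le> side_length r_p / 2}"

definition neighbors :: "real \<Rightarrow> site \<Rightarrow> site \<Rightarrow> bool" where
  "neighbors r_p s t \<longleftrightarrow> s \<noteq> t \<and> square r_p s \<inter> square r_p t \<noteq> {}"

definition occupied :: "real \<Rightarrow> real \<Rightarrow> real \<Rightarrow> 'w network \<Rightarrow> 'w \<Rightarrow> site \<Rightarrow> bool" where
  "occupied R_I r_p r_I net \<omega> s \<longleftrightarrow>
     (\<exists>x \<in> points (secondary net) \<omega>. x \<in> square r_p s \<and> sees_opportunity R_I r_I net \<omega> x)"

text \<open>By stationarity every site has the same occupied probability, so the origin is used.\<close>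

definition occupied_prob :: "real \<Rightarrow> real \<Rightarrow> real \<Rightarrow> 'w network \<Rightarrow> real" where
  "occupied_prob R_I r_p r_I net =
     measure (prob net) {\<omega> \<in> space (prob net). occupied R_I r_p r_I net \<omega> (0, 0)}"

definition origin_percolates :: "real \<Rightarrow> real \<Rightarrow> real \<Rightarrow> 'w network \<Rightarrow> bool" where
  "origin_percolates R_I r_p r_I net \<longleftrightarrow>
     measure (prob net) {\<omega> \<in> space (prob net).
       in_infinite_component {s. occupied R_I r_p r_I net \<omega> s} (neighbors r_p) (0, 0)} > 0"

text \<open>
  All density pairs are considered, each through all networks with these densities on sample
  spaces over \<open>'w\<close>. Both probabilities involved depend only on the law of the network, hence only
  on the densities. Moreover the choice of \<open>'w\<close> is immaterial as soon as \<open>'w\<close> carries some network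
  with \<open>R_p > 0\<close>: the sample space then carries a uniform random variable on \<open>[0,1]\<close>, and therefore
  networks for every density pair.
\<close>

definition percolation_thresholds ::
  "'w itself \<Rightarrow> real \<Rightarrow> real \<Rightarrow> real \<Rightarrow> real \<Rightarrow> real set" where
  "percolation_thresholds (_ :: 'w itself) R_p R_I r_p r_I =
     {q \<in> {0..1}. \<forall>l_S l_PT (net :: 'w network).
        l_S > 0 \<and> l_PT \<ge> 0 \<and> heterogeneous_network R_p l_S l_PT net \<and>
        occupied_prob R_I r_p r_I net > q \<longrightarrow> origin_percolates R_I r_p r_I net}"

definition upper_critical_prob :: "'w itself \<Rightarrow> real \<Rightarrow> real \<Rightarrow> real \<Rightarrow> real \<Rightarrow> real" where
  "upper_critical_prob W R_p R_I r_p r_I = Inf (percolation_thresholds W R_p R_I r_p r_I)"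

text \<open>The infimum is attained, so the critical probability is indeed the minimal threshold.\<close>

lemma upper_critical_prob_minimum:
  "upper_critical_prob W R_p R_I r_p r_I \<in> percolation_thresholds W R_p R_I r_p r_I"
  "q \<in> percolation_thresholds W R_p R_I r_p r_I \<Longrightarrow> upper_critical_prob W R_p R_I r_p r_I \<le> q"
proof -
  let ?T = "percolation_thresholds W R_p R_I r_p r_I"
  have bdd: "bdd_below ?T"
    by (rule bdd_belowI[of _ 0]) (auto simp: percolation_thresholds_def)
  show le: "upper_critical_prob W R_p R_I r_p r_I \<le> q" if "q \<in> ?T" for q
    unfolding upper_critical_prob_def by (rule cInf_lower[OF that bdd])
  have one: "1 \<in> ?T"
  proof -
    have "occupied_prob R_I r_p r_I net \<le> 1" if "heterogeneous_network R_p l_S l_PT net"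
      for l_S l_PT and net :: "'a network"
      using that prob_space.prob_le_1
      unfolding heterogeneous_network_def occupied_prob_def by blast
    then show ?thesis
      unfolding percolation_thresholds_def by (fastforce simp: not_less)
  qed
  have ge0: "0 \<le> Inf ?T"
    using one by (intro cInf_greatest) (auto simp: percolation_thresholds_def)
  have le1: "Inf ?T \<le> 1"
    using le[OF one] by (simp add: upper_critical_prob_def)
  have "origin_percolates R_I r_p r_I net"
    if h: "l_S > 0" "l_PT \<ge> 0" "heterogeneous_network R_p l_S l_PT net"
      "Inf ?T < occupied_prob R_I r_p r_I net" for l_S l_PT and net :: "'a network"
  proof -
    obtain q where "q \<in> ?T" "q < occupied_prob R_I r_p r_I net"
      using h(4) one bdd by (metis cInf_less_iff empty_iff)
    then show ?thesis
      using h(1-3) unfolding percolation_thresholds_def by blast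
  qed
  then show "upper_critical_prob W R_p R_I r_p r_I \<in> ?T"
    using ge0 le1 unfolding upper_critical_prob_def
    by (subst percolation_thresholds_def) auto
qed

section \<open>Overlapping disks\<close>

definition disk_overlap :: "real \<Rightarrow> real \<Rightarrow> real \<Rightarrow> real" where
  "disk_overlap t R_p r_I =
     measure lborel (cball (0 :: plane) R_p \<inter> cball (vector [t, 0]) r_I)"

definition overlap_integral :: "real \<Rightarrow> real \<Rightarrow> real \<Rightarrow> real" where
  "overlap_integral r R_p r_I =
     2 * integral {0..r} (\<lambda>t. t * (disk_overlap t R_p r_I / (pi * R_p\<^sup>2)))"

end

theory Submission
  imports Defs
begin

text \<open>
  The left-hand side of the hypothesis is a lower bound for the occupied probability: the first
  factor is the probability that a square contains a secondary user, the second one the probability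
  that a given location sees an opportunity, a void probability of the Poisson process of
  transmitters marked by their receiver offsets. Hence the origin lies in an infinite occupied
  component with positive probability.

  The existence of such a component somewhere is a tail event for the configurations in the annuli
  \<open>n \<le> norm x < n + 1\<close>: removing finitely many sites from a locally finite graph does not destroy
  all infinite components, and the state of a site depends only on points within a bounded distance.
  Configurations in disjoint annuli are independent, so by Kolmogorov's law the event has
  probability 1. Secondary users in neighboring squares are within distance \<open>r_p\<close>, so an infinite
  occupied component yields an infinite component of the network.
\<close>

section \<open>Independent random elements\<close>

text \<open>The independence granted to a Poisson process concerns only the numbers of points in
  disjoint bounded sets; the indices of its enumeration have no spatial meaning, so the
  configuration in an annulus cannot be isolated through them. Void events can: their probabilities
  are explicit, even for transmitters marked by their offsets. The marks are what calls for the
  Laplace functional: given the positions, such a void event has as its probability a product over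
  the transmitters, whose mean is needed. A transmitter is sorted into annuli by its own position,
  and its receiver follows at distance at most \<open>R_p\<close> almost surely. Occupation is not
  itself a void event, because the user that sees the opportunity has a random location. The
  exponent of the second factor is an expected number of blockers by inclusion-exclusion:
  transmitters within \<open>R_I\<close>, plus those with receiver within \<open>r_I\<close>, minus
  those with both.\<close>

lemma distr_Pair_indep_elements:
  assumes "prob_space M" and ind: "indep_elements M A X B Y"
  shows "distr M (A \<Otimes>\<^sub>M B) (\<lambda>\<omega>. (X \<omega>, Y \<omega>)) = distr M A X \<Otimes>\<^sub>M distr M B Y"
proof -
  interpret prob_space M by fact
  have [measurable]: "X \<in> measurable M A" "Y \<in> measurable M B"
    using ind by (auto simp: indep_elements_def)
  interpret X: prob_space "distr M A X" by (rule prob_space_distr) simp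
  interpret Y: prob_space "distr M B Y" by (rule prob_space_distr) simp
  show ?thesis
  proof (rule sym, rule pair_measure_eqI)
    fix S T assume "S \<in> sets (distr M A X)" "T \<in> sets (distr M B Y)"
    then have [measurable]: "S \<in> sets A" "T \<in> sets B" by auto
    have "prob ((X -` S \<inter> space M) \<inter> (Y -` T \<inter> space M)) = prob (X -` S \<inter> space M) * prob (Y -` T \<inter> space M)"
      using ind unfolding indep_elements_def
      by (intro indep_setD[of "sets (vimage_algebra (space M) X A)" "sets (vimage_algebra (space M) Y B)"])
         (auto intro: in_vimage_algebra)
    moreover have "(X -` S \<inter> space M) \<inter> (Y -` T \<inter> space M) = (\<lambda>\<omega>. (X \<omega>, Y \<omega>)) -` (S \<times> T) \<inter> space M"
      by auto
    ultimately show "emeasure (distr M A X) S * emeasure (distr M B Y) T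
       = emeasure (distr M (A \<Otimes>\<^sub>M B) (\<lambda>\<omega>. (X \<omega>, Y \<omega>))) (S \<times> T)"
      by (simp add: emeasure_distr emeasure_eq_measure ennreal_mult)
  qed (unfold_locales, simp)
qed

text \<open>Fubini for the product law: \<open>\<omega>\<close> and \<open>\<omega>'\<close> act as
  two independent outcomes. It serves to freeze the transmitter positions while the offsets vary,
  and to freeze the secondary users while the primary network varies.\<close>

lemma emeasure_indep_elements:
  assumes "prob_space M" and ind: "indep_elements M A X B Y" and Q: "Q \<in> sets (A \<Otimes>\<^sub>M B)"
  shows "emeasure M {\<omega>\<in>space M. (X \<omega>, Y \<omega>) \<in> Q} =
    (\<integral>\<^sup>+\<omega>. emeasure M {\<omega>'\<in>space M. (X \<omega>, Y \<omega>') \<in> Q} \<partial>M)"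
proof -
  interpret prob_space M by fact
  have [measurable]: "X \<in> measurable M A" "Y \<in> measurable M B"
    using ind by (auto simp: indep_elements_def)
  note Q [measurable]
  interpret Y: prob_space "distr M B Y" by (rule prob_space_distr) simp
  have "emeasure M {\<omega>\<in>space M. (X \<omega>, Y \<omega>) \<in> Q} = emeasure (distr M (A \<Otimes>\<^sub>M B) (\<lambda>\<omega>. (X \<omega>, Y \<omega>))) Q"
    by (subst emeasure_distr) (auto intro!: arg_cong[where f="emeasure M"])
  also have "\<dots> = (\<integral>\<^sup>+x. emeasure (distr M B Y) (Pair x -` Q) \<partial>distr M A X)"
    unfolding distr_Pair_indep_elements[OF assms(1,2)]
    by (rule Y.emeasure_pair_measure_alt) (use Q in simp)
  also have "\<dots> = (\<integral>\<^sup>+\<omega>. emeasure (distr M B Y) (Pair (X \<omega>) -` Q) \<partial>M)"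
    by (rule nn_integral_distr) (auto intro!: Y.measurable_emeasure_Pair)
  also have "\<dots> = (\<integral>\<^sup>+\<omega>. emeasure M {\<omega>'\<in>space M. (X \<omega>, Y \<omega>') \<in> Q} \<partial>M)"
    by (intro nn_integral_cong, subst emeasure_distr) (auto intro!: arg_cong[where f="emeasure M"])
  finally show ?thesis .
qed

lemma prob_indep_elements:
  assumes "prob_space M" and ind: "indep_elements M A X B Y" and ST: "S \<in> sets A" "T \<in> sets B"
  shows "measure M {\<omega>\<in>space M. X \<omega> \<in> S \<and> Y \<omega> \<in> T} =
    measure M {\<omega>\<in>space M. X \<omega> \<in> S} * measure M {\<omega>\<in>space M. Y \<omega> \<in> T}"
proof -
  interpret prob_space M by fact
  have "prob ((X -` S \<inter> space M) \<inter> (Y -` T \<inter> space M)) = prob (X -` S \<inter> space M) * prob (Y -` T \<inter> space M)"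
    using ind ST unfolding indep_elements_def
    by (intro indep_setD[of "sets (vimage_algebra (space M) X A)" "sets (vimage_algebra (space M) Y B)"])
       (auto intro: in_vimage_algebra)
  then show ?thesis
    by (simp add: vimage_def Int_def conj_commute conj_left_commute)
qed

section \<open>Infinite components\<close>

text \<open>
  A path that meets \<open>B\<close> continues, after its last visit to \<open>B\<close>, from one of the finitely many
  neighbors of \<open>B\<close>; so finitely many components of \<open>V - B\<close> cover what is left.
\<close>

lemma infinite_component_remove_finite:
  assumes x: "in_infinite_component V E x" and B: "finite B" and loc: "\<And>v. finite {w. E v w}"
  shows "\<exists>z. in_infinite_component (V - B) E z"
proof -
  let ?R = "(\<lambda>a b. a \<in> V \<and> b \<in> V \<and> E a b)\<^sup>*\<^sup>*"
  let ?S = "(\<lambda>a b. a \<in> V - B \<and> b \<in> V - B \<and> E a b)\<^sup>*\<^sup>*"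
  define Z where "Z = (insert x (\<Union>v\<in>B. {w. E v w})) \<inter> (V - B)"
  have fin: "finite Z" unfolding Z_def using B loc by auto
  have cover: "y \<in> B \<or> (y \<in> V - B \<and> (\<exists>z\<in>Z. ?S z y))" if "?R x y" for y
    using that
  proof (induction rule: rtranclp_induct)
    case base
    then show ?case using x by (auto simp: Z_def in_infinite_component_def)
  next
    case (step y w)
    show ?case
    proof (cases "w \<in> B")
      case False
      with step have w: "w \<in> V - B" by auto
      show ?thesis
      proof (cases "y \<in> B")
        case True
        then have "w \<in> Z" using step w by (auto simp: Z_def)
        then show ?thesis using w by blast
      next
        case False
        with step obtain z where "z \<in> Z" "?S z y" "y \<in> V - B" by auto
        with step w have "?S z w" by (intro rtranclp.rtrancl_into_rtrancl[of _ z y w]) auto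
        then show ?thesis using w \<open>z \<in> Z\<close> by auto
      qed
    qed simp
  qed
  have "infinite (\<Union>z\<in>Z. {y. ?S z y})"
  proof
    assume "finite (\<Union>z\<in>Z. {y. ?S z y})"
    then have "finite (B \<union> (\<Union>z\<in>Z. {y. ?S z y}))" using B by simp
    moreover have "{y. ?R x y} \<subseteq> B \<union> (\<Union>z\<in>Z. {y. ?S z y})" using cover by auto
    ultimately show False using x unfolding in_infinite_component_def by (meson finite_subset)
  qed
  with fin obtain z where "z \<in> Z" "infinite {y. ?S z y}" by blast
  then show ?thesis unfolding in_infinite_component_def Z_def by auto
qed

lemma in_infinite_component_mono:
  assumes "in_infinite_component V E x" "V \<subseteq> W"
  shows "in_infinite_component W E x"
proof -
  have "(\<lambda>a b. a \<in> V \<and> b \<in> V \<and> E a b)\<^sup>*\<^sup>* \<le> (\<lambda>a b. a \<in> W \<and> b \<in> W \<and> E a b)\<^sup>*\<^sup>*"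
    by (rule rtranclp_mono) (use assms in auto)
  then have "{y. (\<lambda>a b. a \<in> V \<and> b \<in> V \<and> E a b)\<^sup>*\<^sup>* x y} \<subseteq> {y. (\<lambda>a b. a \<in> W \<and> b \<in> W \<and> E a b)\<^sup>*\<^sup>* x y}"
    by auto
  then show ?thesis
    using assms unfolding in_infinite_component_def by (meson finite_subset subsetD)
qed

section \<open>The Laplace functional of a Poisson process\<close>

text \<open>Measurability of the count is only implicit in \<open>homogeneous_PPP\<close>:
  independence contains it, and \<open>A, {}, {}, ...\<close> is a disjoint family with
  \<open>A\<close> as a member.\<close>

lemma measurable_num_points:
  assumes M: "prob_space M" and P: "homogeneous_PPP M l P" and A: "A \<in> sets borel" "bounded A"
  shows "num_points P A \<in> measurable M (count_space UNIV)"
proof -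
  interpret prob_space M by fact
  have "indep_vars (\<lambda>_. count_space UNIV) (\<lambda>n. num_points P ((\<lambda>n::nat. if n = 0 then A else {}) n)) UNIV"
    using P A unfolding homogeneous_PPP_def
    by (auto simp: disjoint_family_on_def)
  then have "random_variable (count_space UNIV) (num_points P (if (0::nat) = 0 then A else {}))"
    unfolding indep_vars_def by blast
  then show ?thesis by simp
qed

lemma PPP_generating_function:
  assumes M: "prob_space M" and P: "homogeneous_PPP M l P" and l: "0 \<le> l"
    and A: "A \<in> sets borel" "bounded A" and z: "0 \<le> z"
  shows "(\<integral>\<^sup>+\<omega>. ennreal (z ^ num_points P A \<omega>) \<partial>M) = ennreal (exp (- (l * measure lborel A * (1 - z))))"
proof -
  interpret prob_space M by fact
  note measurable_num_points[OF M P A, measurable]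
  let ?N = "num_points P A" and ?a = "l * measure lborel A"
  have a: "0 \<le> ?a" using l by simp
  have "(\<integral>\<^sup>+\<omega>. ennreal (z ^ ?N \<omega>) \<partial>M)
      = (\<integral>\<^sup>+\<omega>. (\<Sum>k. ennreal (z ^ k) * indicator {\<omega>\<in>space M. ?N \<omega> = k} \<omega>) \<partial>M)"
  proof (rule nn_integral_cong)
    fix \<omega> assume "\<omega> \<in> space M"
    then have "(\<Sum>k. ennreal (z ^ k) * indicator {\<omega>\<in>space M. ?N \<omega> = k} \<omega>)
        = (\<Sum>k\<in>{?N \<omega>}. ennreal (z ^ k) * indicator {\<omega>\<in>space M. ?N \<omega> = k} \<omega>)"
      by (intro suminf_finite) auto
    with \<open>\<omega> \<in> space M\<close>
    show "ennreal (z ^ ?N \<omega>) = (\<Sum>k. ennreal (z ^ k) * indicator {\<omega>\<in>space M. ?N \<omega> = k} \<omega>)"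
      by simp
  qed
  also have "\<dots> = (\<Sum>k. ennreal (z ^ k) * emeasure M {\<omega>\<in>space M. ?N \<omega> = k})"
    by (subst nn_integral_suminf) (simp_all add: nn_integral_cmult)
  also have "\<dots> = (\<Sum>k. ennreal (exp (- ?a) * ((z * ?a) ^ k /\<^sub>R fact k)))"
  proof (rule suminf_cong)
    fix k
    have "measure M {\<omega> \<in> space M. ?N \<omega> = k} = ?a ^ k / fact k * exp (- ?a)"
      using P A unfolding homogeneous_PPP_def by blast
    then show "ennreal (z ^ k) * emeasure M {\<omega>\<in>space M. ?N \<omega> = k}
        = ennreal (exp (- ?a) * ((z * ?a) ^ k /\<^sub>R fact k))"
      using z a
      by (simp add: emeasure_eq_measure ennreal_mult'[symmetric] divide_inverse power_mult_distrib mult_ac)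
  qed
  also have "\<dots> = ennreal (exp (- ?a) * exp (z * ?a))"
    using z a by (intro suminf_ennreal_eq sums_mult exp_converges) (auto intro!: mult_nonneg_nonneg zero_le_power)
  also have "exp (- ?a) * exp (z * ?a) = exp (- (?a * (1 - z)))"
    by (simp add: exp_add[symmetric] algebra_simps)
  finally show ?thesis .
qed

lemma PPP_generating_function_disjoint:
  fixes A :: "nat \<Rightarrow> plane set" and z :: "nat \<Rightarrow> real"
  assumes M: "prob_space M" and P: "homogeneous_PPP M l P" and l: "0 \<le> l"
    and A: "\<And>j. A j \<in> sets borel" "\<And>j. bounded (A j)" "disjoint_family A"
    and z: "\<And>j. 0 \<le> z j" "\<And>j. z j \<le> 1"
  shows "(\<integral>\<^sup>+\<omega>. ennreal (\<Prod>j\<le>n. z j ^ num_points P (A j) \<omega>) \<partial>M)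
    = ennreal (exp (- (l * (\<Sum>j\<le>n. measure lborel (A j) * (1 - z j)))))"
proof -
  interpret prob_space M by fact
  have "indep_vars (\<lambda>_. count_space UNIV) (\<lambda>n. num_points P (A n)) UNIV"
    using P A unfolding homogeneous_PPP_def by blast
  then have "indep_vars (\<lambda>_. borel) (\<lambda>j \<omega>. ennreal (z j ^ num_points P (A j) \<omega>)) UNIV"
    by (rule indep_vars_compose2) auto
  then have "indep_vars (\<lambda>_. borel) (\<lambda>j \<omega>. ennreal (z j ^ num_points P (A j) \<omega>)) {..n}"
    by (rule indep_vars_subset) auto
  then have "(\<integral>\<^sup>+\<omega>. (\<Prod>j\<le>n. ennreal (z j ^ num_points P (A j) \<omega>)) \<partial>M)
      = (\<Prod>j\<le>n. \<integral>\<^sup>+\<omega>. ennreal (z j ^ num_points P (A j) \<omega>) \<partial>M)"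
    by (intro indep_vars_nn_integral) auto
  also have "\<dots> = (\<Prod>j\<le>n. ennreal (exp (- (l * measure lborel (A j) * (1 - z j)))))"
    by (intro prod.cong refl PPP_generating_function M P l A z)
  finally show ?thesis
    using z by (simp add: prod_ennreal exp_sum[symmetric] sum_negf sum_distrib_left mult.assoc)
qed

text \<open>Sorting the points in \<open>B\<close> by the value of \<open>g\<close> turns the
  product into powers of the counts in the disjoint level sets \<open>A j\<close>, to which the
  generating functions apply.\<close>

lemma PPP_step_functional:
  fixes g :: "plane \<Rightarrow> nat"
  assumes M: "prob_space M" and P: "homogeneous_PPP M l P" and l: "0 \<le> l"
    and B: "B \<in> sets borel" "bounded B"
    and g: "g \<in> measurable borel (count_space UNIV)" "\<And>x. g x \<le> n" and n: "0 < n"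
  shows "(\<integral>\<^sup>+\<omega>. ennreal (\<Prod>i | i \<in> indices P \<omega> \<and> snd P i \<omega> \<in> B. 1 - g (snd P i \<omega>) / n) \<partial>M)
    = ennreal (exp (- (l * (\<integral>x. indicator B x * (g x / n) \<partial>lborel))))"
proof -
  interpret prob_space M by fact
  note [measurable] = B(1) g(1)
  define A where "A j = {x\<in>B. g x = j}" for j
  have A_sets[measurable]: "A j \<in> sets borel" for j
    unfolding A_def by measurable
  have A_bounded: "bounded (A j)" for j
    by (rule bounded_subset[OF B(2)]) (auto simp: A_def)
  have A_disj: "disjoint_family A"
    by (auto simp: A_def disjoint_family_on_def)
  have fin: "emeasure lborel (A j) < \<infinity>" for j
    by (intro emeasure_bounded_finite A_bounded)
  have "(\<integral>\<^sup>+\<omega>. ennreal (\<Prod>i | i \<in> indices P \<omega> \<and> snd P i \<omega> \<in> B. 1 - g (snd P i \<omega>) / n) \<partial>M)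
     = (\<integral>\<^sup>+\<omega>. ennreal (\<Prod>j\<le>n. (if j \<le> n then 1 - j / n else 0) ^ num_points P (A j) \<omega>) \<partial>M)"
  proof (rule nn_integral_cong_AE)
    have "AE \<omega> in M. \<forall>A. bounded A \<longrightarrow> finite {i \<in> indices P \<omega>. snd P i \<omega> \<in> A}"
      using P unfolding homogeneous_PPP_def by blast
    then show "AE \<omega> in M. ennreal (\<Prod>i | i \<in> indices P \<omega> \<and> snd P i \<omega> \<in> B. 1 - g (snd P i \<omega>) / n)
      = ennreal (\<Prod>j\<le>n. (if j \<le> n then 1 - j / n else 0) ^ num_points P (A j) \<omega>)"
    proof eventually_elim
      case (elim \<omega>)
      let ?J = "{i \<in> indices P \<omega>. snd P i \<omega> \<in> B}"
      have "(\<Prod>i\<in>?J. 1 - g (snd P i \<omega>) / n)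
          = (\<Prod>j\<le>n. \<Prod>i\<in>{i\<in>?J. g (snd P i \<omega>) = j}. 1 - g (snd P i \<omega>) / n)"
        using elim B(2) g(2) by (intro prod.group[symmetric]) auto
      also have "\<dots> = (\<Prod>j\<le>n. (if j \<le> n then 1 - j / n else 0) ^ num_points P (A j) \<omega>)"
      proof (rule prod.cong[OF refl])
        fix j assume "j \<in> {..n}"
        have "(\<Prod>i\<in>{i\<in>?J. g (snd P i \<omega>) = j}. 1 - g (snd P i \<omega>) / n)
            = (\<Prod>i\<in>{i\<in>?J. g (snd P i \<omega>) = j}. 1 - real j / n)"
          by (rule prod.cong) auto
        also have "\<dots> = (1 - real j / n) ^ num_points P (A j) \<omega>"
          by (simp add: num_points_def A_def conj_assoc)
        finally show "(\<Prod>i\<in>{i\<in>?J. g (snd P i \<omega>) = j}. 1 - g (snd P i \<omega>) / n)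
            = (if j \<le> n then 1 - j / n else 0) ^ num_points P (A j) \<omega>"
          using \<open>j \<in> {..n}\<close> by simp
      qed
      finally show ?case by simp
    qed
  qed
  also have "\<dots> = ennreal (exp (- (l * (\<Sum>j\<le>n. measure lborel (A j) * (1 - (if j \<le> n then 1 - j / n else 0))))))"
    by (rule PPP_generating_function_disjoint[OF M P l A_sets A_bounded A_disj]) (use n in auto)
  also have "(\<Sum>j\<le>n. measure lborel (A j) * (1 - (if j \<le> n then 1 - j / n else 0)))
      = (\<Sum>j\<le>n. \<integral>x. indicator (A j) x * (real j / n) \<partial>lborel)"
    using fin by (intro sum.cong) simp_all
  also have "\<dots> = (\<integral>x. (\<Sum>j\<le>n. indicator (A j) x * (real j / n)) \<partial>lborel)"
    using fin by (intro Bochner_Integration.integral_sum[symmetric]) auto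
  also have "\<dots> = (\<integral>x. indicator B x * (g x / n) \<partial>lborel)"
  proof (rule Bochner_Integration.integral_cong[OF refl])
    fix x
    have "(\<Sum>j\<le>n. indicator (A j) x * (real j / n)) = (\<Sum>j\<in>{g x}. indicator (A j) x * (real j / n))"
      using g(2) by (intro sum.mono_neutral_right) (auto simp: A_def)
    then show "(\<Sum>j\<le>n. indicator (A j) x * (real j / n)) = indicator B x * (g x / n)"
      by (simp add: A_def indicator_def)
  qed
  finally show ?thesis .
qed

text \<open>
  The step functions \<open>\<lceil>n * h\<rceil> / n\<close> and \<open>\<lfloor>n * h\<rfloor> / n\<close> enclose \<open>h\<close> up to \<open>1 / n\<close>.
\<close>

lemma PPP_laplace_functional:
  fixes h :: "plane \<Rightarrow> real"
  assumes M: "prob_space M" and P: "homogeneous_PPP M l P" and l: "0 \<le> l"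
    and B: "B \<in> sets borel" "bounded B"
    and h: "h \<in> borel_measurable borel" "\<And>x. 0 \<le> h x" "\<And>x. h x \<le> 1"
  shows "(\<integral>\<^sup>+\<omega>. ennreal (\<Prod>i | i \<in> indices P \<omega> \<and> snd P i \<omega> \<in> B. 1 - h (snd P i \<omega>)) \<partial>M)
    = ennreal (exp (- (l * (\<integral>x. indicator B x * h x \<partial>lborel))))" (is "?L = ennreal (exp (- (l * ?I)))")
proof -
  note [measurable] = B(1) h(1)
  define b where "b = measure lborel B"
  have fin: "emeasure lborel B < \<infinity>"
    using B(2) by (rule emeasure_bounded_finite)
  have iB: "integrable lborel (indicator B :: plane \<Rightarrow> real)"
    using fin by (simp add: integrable_indicator_iff)
  have bdd: "integrable lborel (\<lambda>x. indicator B x * f x)"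
    if [measurable]: "f \<in> borel_measurable borel" and "\<And>x. \<bar>f x\<bar> \<le> 1" for f :: "plane \<Rightarrow> real"
    by (rule Bochner_Integration.integrable_bound[OF iB])
       (use that(2) in \<open>auto simp: indicator_def\<close>)
  have ih: "integrable lborel (\<lambda>x. indicator B x * h x)"
    by (rule bdd) (use h in auto)
  have n1: "real n * h x \<le> real n" for n x
    using h(3)[of x] mult_left_mono[of "h x" 1 "real n"] by simp
  \<comment> \<open>Rounding up shrinks every factor \<open>1 - g x / n\<close> without making it
    negative, and raises the integral by at most \<open>b / n\<close>.\<close>
  have lower: "ennreal (exp (- (l * (?I + b / Suc k)))) \<le> ?L" for k
  proof -
    define n where "n = Suc k"
    have n0: "0 < n" by (simp add: n_def)
    define g where "g x = nat \<lceil>n * h x\<rceil>" for x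
    have g1: "g x \<le> n" for x
      using n1[of n x] by (auto simp: g_def nat_le_iff ceiling_le_iff)
    have g2: "h x \<le> g x / n" "g x / n \<le> h x + 1 / n" for x
    proof -
      have "0 \<le> n * h x" using h(2) by simp
      then have "n * h x \<le> real (g x)" "real (g x) \<le> n * h x + 1"
        unfolding g_def by linarith+
      then show "h x \<le> g x / n" "g x / n \<le> h x + 1 / n"
        using n0 by (simp_all add: pos_le_divide_eq pos_divide_le_eq distrib_left mult.commute[of _ "real n"])
    qed
    have [measurable]: "g \<in> measurable borel (count_space UNIV)"
      unfolding g_def by measurable
    have i1: "integrable lborel (\<lambda>x. indicator B x * (g x / n))"
      using g1 n0 by (intro bdd) auto
    have i2: "integrable lborel (\<lambda>x. indicator B x * h x + indicator B x * (1 / n))"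
      using ih iB by (intro Bochner_Integration.integrable_add integrable_mult_left)
    have "(\<integral>x. indicator B x * (g x / n) \<partial>lborel) \<le> (\<integral>x. indicator B x * h x + indicator B x * (1 / n) \<partial>lborel)"
      using g2(2) by (intro integral_mono i1 i2) (simp add: indicator_def)
    also have "\<dots> = ?I + b / n"
      using ih iB fin by (simp add: b_def)
    finally have "ennreal (exp (- (l * (?I + b / n)))) \<le> ennreal (exp (- (l * (\<integral>x. indicator B x * (g x / n) \<partial>lborel))))"
      using l by (intro ennreal_leI, simp only: exp_le_cancel_iff neg_le_iff_le) (rule mult_left_mono)
    also have "\<dots> = (\<integral>\<^sup>+\<omega>. ennreal (\<Prod>i | i \<in> indices P \<omega> \<and> snd P i \<omega> \<in> B. 1 - g (snd P i \<omega>) / n) \<partial>M)"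
      using g1 by (intro PPP_step_functional[symmetric] M P l B) (auto simp: n_def)
    also have "\<dots> \<le> ?L"
      using g1 g2(1) n0 by (intro nn_integral_mono ennreal_leI prod_mono) auto
    finally show ?thesis by (simp add: n_def)
  qed
  have upper: "?L \<le> ennreal (exp (- (l * (?I - b / Suc k))))" for k
  proof -
    define n where "n = Suc k"
    have n0: "0 < n" by (simp add: n_def)
    define g where "g x = nat \<lfloor>n * h x\<rfloor>" for x
    have g1: "g x \<le> n" for x
      using n1[of n x] by (auto simp: g_def nat_le_iff floor_le_iff)
    have g2: "g x / n \<le> h x" "h x - 1 / n \<le> g x / n" for x
    proof -
      have "0 \<le> n * h x" using h(2) by simp
      then have "real (g x) \<le> n * h x" "n * h x - 1 \<le> real (g x)"
        unfolding g_def by linarith+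
      then show "g x / n \<le> h x" "h x - 1 / n \<le> g x / n"
        using n0 by (simp_all add: pos_le_divide_eq pos_divide_le_eq right_diff_distrib mult.commute[of _ "real n"])
    qed
    have [measurable]: "g \<in> measurable borel (count_space UNIV)"
      unfolding g_def by measurable
    have i1: "integrable lborel (\<lambda>x. indicator B x * (g x / n))"
      using g1 n0 by (intro bdd) auto
    have i2: "integrable lborel (\<lambda>x. indicator B x * h x - indicator B x * (1 / n))"
      using ih iB by (intro Bochner_Integration.integrable_diff integrable_mult_left)
    have "?L \<le> (\<integral>\<^sup>+\<omega>. ennreal (\<Prod>i | i \<in> indices P \<omega> \<and> snd P i \<omega> \<in> B. 1 - g (snd P i \<omega>) / n) \<partial>M)"
      using g2(1) h(3) by (intro nn_integral_mono ennreal_leI prod_mono) auto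
    also have "\<dots> = ennreal (exp (- (l * (\<integral>x. indicator B x * (g x / n) \<partial>lborel))))"
      using g1 by (intro PPP_step_functional M P l B) (auto simp: n_def)
    finally have *: "?L \<le> ennreal (exp (- (l * (\<integral>x. indicator B x * (g x / n) \<partial>lborel))))" .
    have "?I - b / n = (\<integral>x. indicator B x * h x - indicator B x * (1 / n) \<partial>lborel)"
      using ih iB fin by (simp add: b_def)
    also have "\<dots> \<le> (\<integral>x. indicator B x * (g x / n) \<partial>lborel)"
      using g2(2) by (intro integral_mono i1 i2) (simp add: indicator_def)
    finally have "ennreal (exp (- (l * (\<integral>x. indicator B x * (g x / n) \<partial>lborel)))) \<le> ennreal (exp (- (l * (?I - b / n))))"
      using l by (intro ennreal_leI, simp only: exp_le_cancel_iff neg_le_iff_le) (rule mult_left_mono)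
    with * show ?thesis unfolding n_def by (rule order_trans)
  qed
  have lim0: "(\<lambda>k. b / real (Suc k)) \<longlonglongrightarrow> 0"
    using LIMSEQ_inverse_real_of_nat[THEN tendsto_mult_left, of b] by (simp add: divide_inverse)
  have "(\<lambda>k. ennreal (exp (- (l * (?I + b / Suc k))))) \<longlonglongrightarrow> ennreal (exp (- (l * (?I + 0))))"
    by (intro tendsto_intros lim0)
  then have "ennreal (exp (- (l * ?I))) \<le> ?L"
    using lower by (auto intro: LIMSEQ_le_const2)
  moreover have "(\<lambda>k. ennreal (exp (- (l * (?I - b / Suc k))))) \<longlonglongrightarrow> ennreal (exp (- (l * (?I - 0))))"
    by (intro tendsto_intros lim0)
  then have "?L \<le> ennreal (exp (- (l * ?I)))"
    using upper by (auto intro: LIMSEQ_le_const)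
  ultimately show ?thesis by (rule antisym[rotated])
qed

section \<open>Void probabilities\<close>

definition void :: "'w point_process \<Rightarrow> plane set \<Rightarrow> 'w \<Rightarrow> bool" where
  "void P A \<omega> \<longleftrightarrow> (\<forall>i\<in>indices P \<omega>. snd P i \<omega> \<notin> A)"

text \<open>The mark is the offset rather than the receiver, since it is the offsets that are
  independent of the transmitters. The marked transmitters behave as a Poisson process on
  pairs.\<close>

definition marked_void :: "'w network \<Rightarrow> (plane \<times> plane) set \<Rightarrow> 'w \<Rightarrow> bool" where
  "marked_void net K \<omega> \<longleftrightarrow>
     (\<forall>i\<in>indices (primary_tx net) \<omega>. (snd (primary_tx net) i \<omega>, rx_offset net i \<omega>) \<notin> K)"

lemma pred_enat_less [measurable (raw)]:
  "f \<in> measurable M (count_space UNIV) \<Longrightarrow> Measurable.pred M (\<lambda>x. enat i < f x)"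
  by (rule measurable_compose[where g="\<lambda>n. enat i < n"]) auto

lemma measurable_enumeration_space [measurable]:
  "fst \<in> measurable enumeration_space (count_space UNIV)"
  "(\<lambda>e. snd e i) \<in> measurable enumeration_space borel"
  unfolding enumeration_space_def by measurable

lemma measurable_point_process:
  assumes "enumeration P \<in> measurable M enumeration_space"
  shows "fst P \<in> measurable M (count_space UNIV)" "snd P i \<in> measurable M borel"
  using measurable_compose[OF assms measurable_enumeration_space(1)]
    measurable_compose[OF assms measurable_enumeration_space(2)[of i]]
  by (simp_all add: enumeration_def)

lemma void_iff:
  "void P A \<omega> \<longleftrightarrow> (\<forall>i. enat i < fst (enumeration P \<omega>) \<longrightarrow> snd (enumeration P \<omega>) i \<notin> A)"
  by (auto simp: void_def indices_def enumeration_def)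

lemma void_set:
  assumes [measurable]: "A \<in> sets borel"
  shows "{e \<in> space enumeration_space. \<forall>i. enat i < fst e \<longrightarrow> snd e i \<notin> A} \<in> sets enumeration_space"
  by measurable

lemma PPP_void_prob:
  assumes M: "prob_space M" and P: "homogeneous_PPP M l P"
    and A: "A \<in> sets borel" "bounded A"
  shows "measure M {\<omega>\<in>space M. void P A \<omega>} = exp (- (l * measure lborel A))"
proof -
  interpret prob_space M by fact
  have [measurable]: "enumeration P \<in> measurable M enumeration_space"
    using P unfolding homogeneous_PPP_def by blast
  have "AE \<omega> in M. \<forall>A. bounded A \<longrightarrow> finite {i \<in> indices P \<omega>. snd P i \<omega> \<in> A}"
    using P unfolding homogeneous_PPP_def by blast
  \<comment> \<open>Only almost sure, by local finiteness: \<open>card\<close> of an infinite set is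
    \<open>0\<close>, so a vanishing count alone does not mean emptiness.\<close>
  then have "AE \<omega> in M. void P A \<omega> \<longleftrightarrow> num_points P A \<omega> = 0"
  proof eventually_elim
    case (elim \<omega>)
    then show ?case using A by (auto simp: void_def num_points_def)
  qed
  moreover have "{\<omega>\<in>space M. void P A \<omega>} \<in> sets M"
  proof -
    have "{\<omega>\<in>space M. void P A \<omega>} = enumeration P -` {e \<in> space enumeration_space. \<forall>i. enat i < fst e \<longrightarrow> snd e i \<notin> A} \<inter> space M"
      using measurable_space[of "enumeration P" M enumeration_space] by (auto simp: void_iff)
    then show ?thesis using void_set[OF A(1)] by simp
  qed
  moreover have "{\<omega>\<in>space M. num_points P A \<omega> = 0} \<in> sets M"
    using measurable_num_points[OF M P A] by measurable
  ultimately have "measure M {\<omega>\<in>space M. void P A \<omega>} = measure M {\<omega>\<in>space M. num_points P A \<omega> = 0}"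
    by (intro measure_eq_AE) auto
  also have "\<dots> = (l * measure lborel A) ^ 0 / fact 0 * exp (- (l * measure lborel A))"
    using P A unfolding homogeneous_PPP_def by blast
  finally show ?thesis by simp
qed

section \<open>Void probabilities for transmitters marked by their receiver offsets\<close>

locale network_model =
  fixes net :: "'w network" and R_p l_S l_PT :: real
  assumes R_p: "0 < R_p" and l_S: "0 < l_S" and l_PT: "0 \<le> l_PT"
    and network: "heterogeneous_network R_p l_S l_PT net"
begin

abbreviation M :: "'w measure" where "M \<equiv> Defs.prob net"
abbreviation S :: "'w point_process" where "S \<equiv> secondary net"
abbreviation T :: "'w point_process" where "T \<equiv> primary_tx net"
abbreviation marks :: "plane measure" where "marks \<equiv> uniform_measure lborel (cball 0 R_p)"

lemma prob_space_M: "prob_space M"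
  and PPP_S: "homogeneous_PPP M l_S S"
  and PPP_T: "homogeneous_PPP M l_PT T"
  and distr_rx_offset: "distr M borel (rx_offset net i) = marks"
  and indep_rx_offset: "prob_space.indep_vars M (\<lambda>_. borel) (rx_offset net) UNIV"
  and indep_T: "indep_elements M enumeration_space (enumeration T)
       (\<Pi>\<^sub>M i\<in>UNIV. borel) (\<lambda>\<omega> i. rx_offset net i \<omega>)"
  and indep_S: "indep_elements M enumeration_space (enumeration S)
       (enumeration_space \<Otimes>\<^sub>M (\<Pi>\<^sub>M i\<in>UNIV. borel)) (\<lambda>\<omega>. (enumeration T \<omega>, \<lambda>i. rx net i \<omega>))"
  using network unfolding heterogeneous_network_def by blast+

lemma measurable_network [measurable]:
  "enumeration S \<in> measurable M enumeration_space"
  "enumeration T \<in> measurable M enumeration_space"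
  "fst S \<in> measurable M (count_space UNIV)"
  "snd S i \<in> measurable M borel"
  "fst T \<in> measurable M (count_space UNIV)"
  "snd T i \<in> measurable M borel"
  "rx_offset net i \<in> measurable M borel"
  "rx net i \<in> measurable M borel"
proof -
  show 1: "enumeration S \<in> measurable M enumeration_space" "enumeration T \<in> measurable M enumeration_space"
    using PPP_S PPP_T unfolding homogeneous_PPP_def by blast+
  show "fst S \<in> measurable M (count_space UNIV)" "snd S i \<in> measurable M borel"
    "fst T \<in> measurable M (count_space UNIV)" and T: "snd T i \<in> measurable M borel"
    using 1 measurable_point_process by blast+
  show R: "rx_offset net i \<in> measurable M borel"
    using indep_rx_offset unfolding prob_space.indep_vars_def[OF prob_space_M] by simp
  have "(\<lambda>\<omega>. rx_offset net i \<omega> + snd T i \<omega>) \<in> measurable M borel"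
    using T R by (intro borel_measurable_add)
  then show "rx net i \<in> measurable M borel"
    by (simp add: rx_offset_def)
qed

lemma prob_space_marks: "prob_space marks"
  by (rule prob_space_uniform_measure)
     (use R_p unit_ball_vol_pos[of 2] emeasure_lborel_cball_finite[of "0::plane" R_p] in
       \<open>auto simp: emeasure_cball simp del: unit_ball_vol_pos\<close>)

text \<open>Mean measure per unit density: when this mass is finite,
  \<open>l_PT * intensity K\<close> is the expected number of transmitters whose position and offset
  form a pair in \<open>K\<close>.\<close>

definition intensity :: "(plane \<times> plane) set \<Rightarrow> real" where
  "intensity K = measure (lborel \<Otimes>\<^sub>M marks) K"

text \<open>Cavalieri's principle, slicing at a fixed position. An infinite mass becomes the default
  value \<open>0\<close> on both sides.\<close>

lemma intensity_integral:
  assumes K: "K \<in> sets borel"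
  shows "intensity K = (\<integral>x. measure marks {u. (x, u) \<in> K} \<partial>lborel)"
proof -
  interpret marks: prob_space marks by (rule prob_space_marks)
  have K'[measurable]: "K \<in> sets (lborel \<Otimes>\<^sub>M marks)"
    using K by (simp add: borel_prod[symmetric] cong: sets_pair_measure_cong)
  have *: "(\<lambda>x. measure marks {u. (x, u) \<in> K}) = (\<lambda>x. measure marks (Pair x -` K))"
    by (simp add: vimage_def)
  have [measurable]: "(\<lambda>x. measure marks (Pair x -` K)) \<in> borel_measurable lborel"
    unfolding measure_def using marks.measurable_emeasure_Pair[OF K'] by measurable
  have "intensity K = enn2real (\<integral>\<^sup>+x. emeasure marks (Pair x -` K) \<partial>lborel)"
    unfolding intensity_def measure_def by (subst marks.emeasure_pair_measure_alt[OF K']) simp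
  also have "\<dots> = (\<integral>x. measure marks (Pair x -` K) \<partial>lborel)"
    by (subst integral_eq_nn_integral) (auto simp: marks.emeasure_eq_measure)
  finally show ?thesis by (simp add: *)
qed

lemma prob_rx_offsets:
  assumes J: "finite J" and A: "\<And>i. i \<in> J \<Longrightarrow> A i \<in> sets borel"
  shows "measure M {\<omega>\<in>space M. \<forall>i\<in>J. rx_offset net i \<omega> \<in> A i} = (\<Prod>i\<in>J. measure marks (A i))"
proof (cases "J = {}")
  case True
  then show ?thesis using prob_space.prob_space[OF prob_space_M] by simp
next
  case False
  interpret prob_space M by (rule prob_space_M)
  have "measure M (\<Inter>i\<in>J. rx_offset net i -` A i \<inter> space M) = (\<Prod>i\<in>J. measure M (rx_offset net i -` A i \<inter> space M))"
    by (rule indep_varsD[OF indep_rx_offset False J]) (use A in auto)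
  also have "(\<Inter>i\<in>J. rx_offset net i -` A i \<inter> space M) = {\<omega>\<in>space M. \<forall>i\<in>J. rx_offset net i \<omega> \<in> A i}"
    using False by auto
  also have "(\<Prod>i\<in>J. measure M (rx_offset net i -` A i \<inter> space M)) = (\<Prod>i\<in>J. measure marks (A i))"
    by (intro prod.cong refl, subst distr_rx_offset[symmetric]) (use A in \<open>auto simp: measure_distr\<close>)
  finally show ?thesis .
qed

lemma marked_void_set:
  assumes [measurable]: "K \<in> sets borel"
  shows "{x \<in> space (enumeration_space \<Otimes>\<^sub>M (\<Pi>\<^sub>M i\<in>UNIV. borel)). \<forall>i. enat i < fst (fst x) \<longrightarrow> (snd (fst x) i, snd x i) \<notin> K}
    \<in> sets (enumeration_space \<Otimes>\<^sub>M (\<Pi>\<^sub>M i\<in>UNIV. borel :: plane measure))"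
proof -
  have [measurable]: "K \<in> sets (borel \<Otimes>\<^sub>M borel)" by (subst borel_prod) (rule assms)
  show ?thesis
    by measurable
qed

text \<open>The marking theorem for void probabilities. Given the positions, a transmitter at
  \<open>x\<close> avoids \<open>K\<close> with probability \<open>1 - h x\<close>, independently of
  the others, and the Laplace functional averages the product. As \<open>K\<close> lies over the
  bounded set \<open>B\<close>, almost surely only finitely many factors occur.\<close>

lemma marked_void_prob:
  assumes K[measurable]: "K \<in> sets borel" and B: "B \<in> sets borel" "bounded B" "K \<subseteq> B \<times> UNIV"
  shows "measure M {\<omega>\<in>space M. marked_void net K \<omega>} = exp (- (l_PT * intensity K))"
proof -
  interpret marks: prob_space marks by (rule prob_space_marks)
  interpret prob_space M by (rule prob_space_M)
  define h where "h x = measure marks {u. (x, u) \<in> K}" for x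
  have slice[measurable]: "{u. (x, u) \<in> K} \<in> sets borel" for x
    using sets_Pair1[of K borel borel x] K by (simp add: borel_prod vimage_def)
  have K'[measurable]: "K \<in> sets (lborel \<Otimes>\<^sub>M marks)"
    using K by (simp add: borel_prod[symmetric] cong: sets_pair_measure_cong)
  have [measurable]: "h \<in> borel_measurable borel"
    using marks.measurable_emeasure_Pair[OF K'] unfolding h_def measure_def vimage_def by measurable
  let ?Q = "{x \<in> space (enumeration_space \<Otimes>\<^sub>M (\<Pi>\<^sub>M i\<in>UNIV. borel)). \<forall>i. enat i < fst (fst x) \<longrightarrow> (snd (fst x) i, snd x i) \<notin> K}"
  let ?U = "\<lambda>\<omega> i. rx_offset net i \<omega>"
  have E: "enumeration T \<omega> \<in> space enumeration_space" if "\<omega> \<in> space M" for \<omega>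
    using that measurable_space[OF measurable_network(2)] by blast
  have iff: "(enumeration T \<omega>, ?U \<omega>') \<in> ?Q \<longleftrightarrow> (\<forall>i\<in>indices T \<omega>. (snd T i \<omega>, rx_offset net i \<omega>') \<notin> K)"
    if "\<omega> \<in> space M" for \<omega> \<omega>'
    using E[OF that] by (auto simp: space_pair_measure space_PiM indices_def enumeration_def)
  have "AE \<omega> in M. \<forall>A. bounded A \<longrightarrow> finite {i \<in> indices T \<omega>. snd T i \<omega> \<in> A}"
    using PPP_T unfolding homogeneous_PPP_def by blast
  then have ae: "AE \<omega> in M. emeasure M {\<omega>'\<in>space M. (enumeration T \<omega>, ?U \<omega>') \<in> ?Q}
    = ennreal (\<Prod>i | i \<in> indices T \<omega> \<and> snd T i \<omega> \<in> B. 1 - h (snd T i \<omega>))"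
  proof (rule AE_mp, intro AE_I2 impI)
    fix \<omega> assume \<omega>: "\<omega> \<in> space M" and "\<forall>A. bounded A \<longrightarrow> finite {i \<in> indices T \<omega>. snd T i \<omega> \<in> A}"
    then have fin: "finite {i \<in> indices T \<omega>. snd T i \<omega> \<in> B}" using B by blast
    have "{\<omega>'\<in>space M. (enumeration T \<omega>, ?U \<omega>') \<in> ?Q}
      = {\<omega>'\<in>space M. \<forall>i\<in>{i \<in> indices T \<omega>. snd T i \<omega> \<in> B}. rx_offset net i \<omega>' \<in> - {u. (snd T i \<omega>, u) \<in> K}}"
      using B(3) by (subst iff[OF \<omega>]) blast
    moreover have "measure M \<dots> = (\<Prod>i\<in>{i \<in> indices T \<omega>. snd T i \<omega> \<in> B}. measure marks (- {u. (snd T i \<omega>, u) \<in> K}))"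
      by (rule prob_rx_offsets[OF fin]) auto
    moreover have "measure marks (- {u. (x, u) \<in> K}) = 1 - h x" for x
      using marks.prob_compl[of "{u. (x, u) \<in> K}"] by (simp add: h_def Compl_eq_Diff_UNIV)
    ultimately show "emeasure M {\<omega>'\<in>space M. (enumeration T \<omega>, ?U \<omega>') \<in> ?Q}
      = ennreal (\<Prod>i | i \<in> indices T \<omega> \<and> snd T i \<omega> \<in> B. 1 - h (snd T i \<omega>))"
      by (simp add: emeasure_eq_measure)
  qed
  have "emeasure M {\<omega>\<in>space M. marked_void net K \<omega>} = emeasure M {\<omega>\<in>space M. (enumeration T \<omega>, ?U \<omega>) \<in> ?Q}"
    by (intro arg_cong[where f="emeasure M"] Collect_cong conj_cong refl) (simp only: iff marked_void_def)
  also have "\<dots> = (\<integral>\<^sup>+\<omega>. emeasure M {\<omega>'\<in>space M. (enumeration T \<omega>, ?U \<omega>') \<in> ?Q} \<partial>M)"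
    by (rule emeasure_indep_elements[OF prob_space_M indep_T marked_void_set[OF K]])
  also have "\<dots> = (\<integral>\<^sup>+\<omega>. ennreal (\<Prod>i | i \<in> indices T \<omega> \<and> snd T i \<omega> \<in> B. 1 - h (snd T i \<omega>)) \<partial>M)"
    by (rule nn_integral_cong_AE[OF ae])
  also have "\<dots> = ennreal (exp (- (l_PT * (\<integral>x. indicator B x * h x \<partial>lborel))))"
    by (rule PPP_laplace_functional[OF prob_space_M PPP_T l_PT B(1,2)]) (auto simp: h_def)
  also have "(\<integral>x. indicator B x * h x \<partial>lborel) = intensity K"
    unfolding intensity_integral[OF K]
  proof (rule Bochner_Integration.integral_cong[OF refl])
    fix x
    have "{u. (x, u) \<in> K} = {}" if "x \<notin> B" using that B(3) by auto
    then show "indicator B x * h x = measure marks {u. (x, u) \<in> K}"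
      by (cases "x \<in> B") (auto simp: h_def)
  qed
  finally show ?thesis by (simp add: emeasure_eq_measure)
qed

end

section \<open>The intensity of blocking transmitters\<close>

lemma emeasure_cball_plane:
  "0 \<le> r \<Longrightarrow> emeasure lborel (cball (c :: plane) r) = ennreal (pi * r\<^sup>2)"
  by (simp add: emeasure_cball unit_ball_vol_2)

lemma measure_cball_plane:
  "0 \<le> r \<Longrightarrow> measure lborel (cball (c :: plane) r) = pi * r\<^sup>2"
  by (simp add: content_cball unit_ball_vol_2)

text \<open>Polar coordinates: both sides integrate \<open>g\<close> against the law of the norm on a disk, and the
  area \<open>pi * s\<^sup>2\<close> of the disk of radius \<open>s\<close> is the primitive of \<open>2 * pi * t\<close>.\<close>

lemma integral_radial_plane:
  fixes g :: "real \<Rightarrow> real"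
  assumes [measurable]: "g \<in> borel_measurable borel" and R: "0 \<le> R"
  shows "(\<integral>x. indicator (cball (0::plane) R) x * g (norm x) \<partial>lborel)
    = (\<integral>t. indicator {0..R} t * (2 * pi * t * g t) \<partial>lborel)"
proof -
  define M1 where "M1 = distr (density lborel (indicator (cball (0::plane) R))) borel norm"
  define M2 where "M2 = density lborel (\<lambda>t. ennreal (2 * pi * t * indicator {0..R} t))"
  have e1: "emeasure M1 {..s} = (if s < 0 then 0 else ennreal (pi * (min R s)\<^sup>2))" for s
  proof -
    have "norm -` {..s} = cball (0::plane) s" by auto
    then have "emeasure M1 {..s} = emeasure (density lborel (indicator (cball (0::plane) R))) (cball 0 s)"
      unfolding M1_def by (simp add: emeasure_distr)
    also have "\<dots> = emeasure lborel (cball (0::plane) R \<inter> cball 0 s)"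
      by (rule emeasure_restricted) auto
    also have "cball (0::plane) R \<inter> cball 0 s = (if s < 0 then {} else cball 0 (min R s))"
      by auto
    finally show ?thesis using R by (simp add: emeasure_cball_plane)
  qed
  have e2: "emeasure M2 {..s} = (if s < 0 then 0 else ennreal (pi * (min R s)\<^sup>2))" for s
  proof -
    have "emeasure M2 {..s} = (\<integral>\<^sup>+t. ennreal (2 * pi * t * indicator {0..R} t) * indicator {..s} t \<partial>lborel)"
      unfolding M2_def by (subst emeasure_density) auto
    also have "\<dots> = (\<integral>\<^sup>+t. ennreal (2 * pi * t) * indicator {0..min R s} t \<partial>lborel)"
      by (intro nn_integral_cong) (auto simp: indicator_def)
    also have "\<dots> = (if s < 0 then 0 else ennreal (pi * (min R s)\<^sup>2))"
    proof (cases "s < 0")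
      case False
      have "(\<integral>\<^sup>+t. ennreal (2 * pi * t) * indicator {0..min R s} t \<partial>lborel) = pi * (min R s)\<^sup>2 - pi * 0\<^sup>2"
        using R False
        by (intro nn_integral_FTC_Icc) (auto intro!: derivative_eq_intros)
      then show ?thesis using False by simp
    qed simp
    finally show ?thesis .
  qed
  have cdf: "cdf M1 = cdf M2"
    by (rule ext) (simp add: cdf_def measure_def e1 e2)
  have "M1 = M2"
  proof (rule cdf_unique'[OF _ _ cdf])
    show "finite_borel_measure M1"
    proof (intro finite_borel_measure.intro finite_measureI finite_borel_measure_axioms.intro)
      have "emeasure M1 (space M1) = emeasure (density lborel (indicator (cball (0::plane) R))) UNIV"
        unfolding M1_def by (subst emeasure_distr) auto
      also have "\<dots> = emeasure lborel (cball (0::plane) R \<inter> UNIV)"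
        by (rule emeasure_restricted) auto
      finally have "emeasure M1 (space M1) = emeasure lborel (cball (0::plane) R)" by simp
      then show "emeasure M1 (space M1) \<noteq> \<infinity>"
        using R by (simp add: emeasure_cball_plane)
    qed (simp add: M1_def)
    show "finite_borel_measure M2"
    proof (intro finite_borel_measure.intro finite_measureI finite_borel_measure_axioms.intro)
      have "emeasure M2 (space M2) = emeasure M2 {..R}"
        unfolding M2_def by (subst (1 2) emeasure_density) (auto intro!: nn_integral_cong simp: indicator_def)
      then show "emeasure M2 (space M2) \<noteq> \<infinity>" by (simp add: e2)
    qed (simp add: M2_def)
  qed
  moreover have "(\<integral>t. g t \<partial>M1) = (\<integral>x. indicator (cball (0::plane) R) x * g (norm x) \<partial>lborel)"
  proof -
    have "M1 = distr (density lborel (\<lambda>x. ennreal (indicator (cball (0::plane) R) x))) borel norm"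
      unfolding M1_def by (simp add: ennreal_indicator)
    then show ?thesis
      by (simp add: integral_distr) (subst integral_density, auto intro!: borel_measurable_indicator)
  qed
  moreover have "(\<integral>t. g t \<partial>M2) = (\<integral>t. indicator {0..R} t * (2 * pi * t * g t) \<partial>lborel)"
    unfolding M2_def
    by (subst integral_density) (auto intro!: AE_I2 Bochner_Integration.integral_cong simp: indicator_def)
  ultimately show ?thesis by simp
qed

text \<open>An orthogonal map carrying \<open>vector [norm y, 0]\<close> to \<open>y\<close>
  preserves area and the disk around the origin.\<close>

lemma measure_disk_overlap:
  fixes y :: plane
  shows "measure lborel (cball 0 R_p \<inter> cball y r_I) = disk_overlap (norm y) R_p r_I"
proof -
  have "norm (vector [norm y, 0] :: plane) = norm y"
    by (simp add: norm_vec_def L2_set_def sum_2)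
  then obtain f where f: "orthogonal_transformation f" "f (vector [norm y, 0] :: plane) = y"
    by (rule orthogonal_transformation_exists)
  have inj: "inj f" using f(1) by (rule orthogonal_transformation_inj)
  have "f ` (cball 0 R_p \<inter> cball (vector [norm y, 0]) r_I) = cball 0 R_p \<inter> cball y r_I"
    using f by (simp add: image_Int[OF inj] image_orthogonal_transformation_cball linear_0 orthogonal_transformation_linear)
  moreover have "measure lebesgue (f ` (cball 0 R_p \<inter> cball (vector [norm y, 0]) r_I))
      = measure lebesgue (cball 0 R_p \<inter> cball (vector [norm y, 0] :: plane) r_I)"
    by (rule measure_orthogonal_image[OF f(1)]) (simp add: lmeasurable_compact compact_Int)
  ultimately show ?thesis by (simp add: disk_overlap_def)
qed

text \<open>The overlap is the area of a section of a subset of \<open>real \<times> plane\<close>,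
  which is seen to be closed once the center is written as
  \<open>t *\<^sub>R vector [1, 0]\<close>.\<close>

lemma measurable_disk_overlap [measurable]:
  "(\<lambda>t. disk_overlap t R_p r_I) \<in> borel_measurable borel"
proof -
  have "(\<lambda>t. measure lborel {y::plane. dist 0 y \<le> R_p \<and> dist (t *\<^sub>R vector [1, 0]) y \<le> r_I}) \<in> borel_measurable borel"
  proof (rule lborel.measurable_measure)
    have "closed {p :: real \<times> plane. dist 0 (snd p) \<le> R_p \<and> dist (fst p *\<^sub>R vector [1, 0]) (snd p) \<le> r_I}"
      by (intro closed_Collect_conj closed_Collect_le continuous_intros)
    moreover have "sets (borel \<Otimes>\<^sub>M lborel) = sets (borel :: (real \<times> plane) measure)"
      unfolding borel_prod[symmetric] by (rule sets_pair_measure_cong) auto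
    ultimately show "{p \<in> space (borel \<Otimes>\<^sub>M lborel). snd p \<in> {y::plane. dist 0 y \<le> R_p \<and> dist (fst p *\<^sub>R vector [1, 0]) y \<le> r_I}}
        \<in> sets (borel \<Otimes>\<^sub>M lborel)"
      by (simp add: space_pair_measure)
  qed simp
  moreover have "{y::plane. dist 0 y \<le> R_p \<and> dist (t *\<^sub>R vector [1, 0]) y \<le> r_I} = cball 0 R_p \<inter> cball (vector [t, 0]) r_I" for t
  proof -
    have "t *\<^sub>R vector [1, 0] = (vector [t, 0] :: plane)"
      by (simp add: vec_eq_iff forall_2)
    then show ?thesis by (simp add: cball_def Int_def)
  qed
  ultimately show ?thesis unfolding disk_overlap_def by (simp only:)
qed

context network_model begin

lemma measure_marks:
  "A \<in> sets borel \<Longrightarrow> measure marks A = measure lborel (cball 0 R_p \<inter> A) / (pi * R_p\<^sup>2)"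
  using R_p by (subst measure_uniform_measure) (auto simp: emeasure_cball_plane measure_cball_plane)

lemma measure_marks_shifted_disk:
  "measure marks {u. dist x (t + u) \<le> r_I} = disk_overlap (norm (x - t)) R_p r_I / (pi * R_p\<^sup>2)"
proof -
  have "{u. dist x (t + u) \<le> r_I} = cball (x - t) r_I"
    by (auto simp: dist_norm algebra_simps)
  then show ?thesis
    by (simp add: measure_marks measure_disk_overlap)
qed

text \<open>
  The positions and marks of transmitters that deny an opportunity at \<open>x\<close>. The condition on \<open>u\<close>
  holds almost surely; it makes the positions range over a bounded set.
\<close>

definition blocking :: "real \<Rightarrow> real \<Rightarrow> plane \<Rightarrow> (plane \<times> plane) set" where
  "blocking R_I r_I x = {(t, u). dist 0 u \<le> R_p \<and> (dist x t \<le> R_I \<or> dist x (t + u) \<le> r_I)}"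

lemma blocking_sets [measurable]: "blocking R_I r_I x \<in> sets borel"
  unfolding blocking_def case_prod_beta
  by (intro borel_closed closed_Collect_conj closed_Collect_disj closed_Collect_le continuous_intros)

text \<open>After moving \<open>x\<close> to the origin, polar coordinates give the weight
  \<open>2 * pi * t\<close>; the \<open>2\<close> belongs to \<open>overlap_integral\<close> and
  \<open>pi\<close> is left over.\<close>

lemma overlap_integral_eq:
  fixes x :: plane
  assumes R_I: "0 \<le> R_I"
  shows "(\<integral>t. indicator (cball x R_I) t * (disk_overlap (norm (x - t)) R_p r_I / (pi * R_p\<^sup>2)) \<partial>lborel)
    = pi * overlap_integral R_I R_p r_I"
proof -
  let ?g = "\<lambda>t. disk_overlap t R_p r_I / (pi * R_p\<^sup>2)"
  have bound: "0 \<le> ?g t" "?g t \<le> 1" for t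
  proof -
    have "disk_overlap t R_p r_I \<le> measure lborel (cball (0::plane) R_p)"
      unfolding disk_overlap_def using R_p
      by (intro measure_mono_fmeasurable fmeasurableI) (auto simp: emeasure_cball_plane)
    then show "0 \<le> ?g t" "?g t \<le> 1"
      using R_p by (auto simp: measure_cball_plane disk_overlap_def divide_le_eq_1)
  qed
  \<comment> \<open>\<open>overlap_integral\<close> is a gauge integral; absolute integrability
    identifies it with the Lebesgue integral. The integrand stays below \<open>R_I\<close> because
    the overlap is at most the area of the disk of radius \<open>R_p\<close>.\<close>
  have int: "set_integrable lborel {0..R_I} (\<lambda>t. t * ?g t)"
    unfolding set_integrable_def
  proof (rule Bochner_Integration.integrable_bound)
    show "integrable lborel (\<lambda>t. R_I * indicator {0..R_I} t)"
      using R_I by (intro integrable_mult_right integrable_real_indicator) auto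
    show "AE t in lborel. norm (indicator {0..R_I} t *\<^sub>R (t * ?g t)) \<le> norm (R_I * indicator {0..R_I} t)"
    proof (rule AE_I2)
      fix t
      have "\<bar>t * ?g t\<bar> \<le> R_I" if "0 \<le> t" "t \<le> R_I"
      proof -
        have "0 \<le> t * ?g t" using bound[of t] that by (intro mult_nonneg_nonneg)
        moreover have "t * ?g t \<le> R_I * 1" using bound[of t] that by (intro mult_mono) auto
        ultimately show ?thesis by linarith
      qed
      then show "norm (indicator {0..R_I} t *\<^sub>R (t * ?g t)) \<le> norm (R_I * indicator {0..R_I} t)"
        using R_I by (auto simp: indicator_def)
    qed
  qed measurable
  have "(\<integral>t. indicator (cball x R_I) t * ?g (norm (x - t)) \<partial>lborel)
      = (\<integral>t. indicator (cball x R_I) t * ?g (norm (x - t)) \<partial>distr lborel borel ((+) x))"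
    by (simp add: lborel_distr_plus)
  also have "\<dots> = (\<integral>s. indicator (cball x R_I) (x + s) * ?g (norm (x - (x + s))) \<partial>lborel)"
  proof (rule integral_distr)
    have "(\<lambda>t. ?g (norm (x - t))) \<in> borel_measurable borel"
      by (rule measurable_compose[where f="\<lambda>t. norm (x - t)" and g="?g"]) measurable
    then show "(\<lambda>t. indicator (cball x R_I) t * ?g (norm (x - t))) \<in> borel_measurable borel"
      by (intro borel_measurable_times borel_measurable_indicator) auto
  qed measurable
  also have "\<dots> = (\<integral>s. indicator (cball (0::plane) R_I) s * ?g (norm s) \<partial>lborel)"
    by (rule Bochner_Integration.integral_cong[OF refl]) (auto simp: indicator_def dist_norm)
  also have "\<dots> = (\<integral>t. indicator {0..R_I} t * (2 * pi * t * ?g t) \<partial>lborel)"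
    by (rule integral_radial_plane[OF _ R_I]) measurable
  also have "\<dots> = (\<integral>t. (2 * pi) * (indicator {0..R_I} t *\<^sub>R (t * ?g t)) \<partial>lborel)"
    by (rule Bochner_Integration.integral_cong[OF refl]) simp
  also have "\<dots> = 2 * pi * (LINT t:{0..R_I}|lborel. t * ?g t)"
    unfolding set_lebesgue_integral_def by (rule integral_mult_right_zero)
  also have "(LINT t:{0..R_I}|lborel. t * ?g t) = integral {0..R_I} (\<lambda>t. t * ?g t)"
    by (rule set_borel_integral_eq_integral[OF int])
  finally show ?thesis by (simp add: overlap_integral_def)
qed

text \<open>Inclusion-exclusion for the pairs with transmitter within \<open>R_I\<close>
  (\<open>A\<close>) and those with receiver within \<open>r_I\<close> (\<open>B\<close>). Adding a
  random offset preserves area, hence the plain disk area for \<open>B\<close>; the overlap integral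
  comes from \<open>A \<inter> B\<close>.\<close>

lemma intensity_blocking:
  assumes R_I: "0 \<le> R_I" and r_I: "0 \<le> r_I"
  shows "intensity (blocking R_I r_I x) = pi * (R_I\<^sup>2 + r_I\<^sup>2 - overlap_integral R_I R_p r_I)"
proof -
  interpret marks: prob_space marks by (rule prob_space_marks)
  define A B :: "(plane \<times> plane) set" where "A = {(t, u). dist x t \<le> R_I}" and "B = {(t, u). dist x (t + u) \<le> r_I}"
  have AB: "A \<in> sets borel" "B \<in> sets borel"
    unfolding A_def B_def case_prod_beta
    by (intro borel_closed closed_Collect_le continuous_intros)+
  have sets_eq: "sets (lborel \<Otimes>\<^sub>M marks) = sets (borel :: (plane \<times> plane) measure)"
    unfolding borel_prod[symmetric] by (rule sets_pair_measure_cong) auto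
  interpret pair_sigma_finite lborel marks ..
  have AB': "A \<in> sets (lborel \<Otimes>\<^sub>M marks)" "B \<in> sets (lborel \<Otimes>\<^sub>M marks)"
    unfolding sets_eq by (fact AB)+
  have eA: "emeasure (lborel \<Otimes>\<^sub>M marks) A = ennreal (pi * R_I\<^sup>2)"
  proof -
    have "emeasure marks (Pair t -` A) = indicator (cball x R_I) t" for t
      using marks.emeasure_space_1 by (cases "dist x t \<le> R_I") (simp_all add: A_def vimage_def)
    then show ?thesis
      using R_I by (subst marks.emeasure_pair_measure_alt[OF AB'(1)]) (simp add: emeasure_cball_plane)
  qed
  have eB: "emeasure (lborel \<Otimes>\<^sub>M marks) B = ennreal (pi * r_I\<^sup>2)"
  proof -
    \<comment> \<open>Slicing at a fixed offset instead of a fixed position makes every slice a disk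
      of the same area.\<close>
    have "(\<lambda>t. (t, u)) -` B = cball (x - u) r_I" for u
      by (auto simp: B_def dist_norm algebra_simps)
    then show ?thesis
      using r_I marks.emeasure_space_1
      by (subst emeasure_pair_measure_alt2[OF AB'(2)]) (simp add: emeasure_cball_plane)
  qed
  have "intensity (blocking R_I r_I x) = intensity (A \<union> B)"
  proof -
    have "measure marks {u. (t, u) \<in> blocking R_I r_I x} = measure marks {u. (t, u) \<in> A \<union> B}" for t
    proof -
      \<comment> \<open>The extra condition in \<open>blocking\<close> holds throughout
        \<open>cball 0 R_p\<close>, which carries the whole mass of \<open>marks\<close>.\<close>
      have "cball 0 R_p \<inter> {u. (t, u) \<in> blocking R_I r_I x} = cball 0 R_p \<inter> {u. (t, u) \<in> A \<union> B}"
        by (auto simp: blocking_def A_def B_def)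
      moreover have "{u. (t, u) \<in> blocking R_I r_I x} \<in> sets borel" "{u. (t, u) \<in> A \<union> B} \<in> sets borel"
        unfolding blocking_def A_def B_def mem_Collect_eq case_prod_conv Un_iff
        by (intro borel_closed closed_Collect_conj closed_Collect_disj closed_Collect_le continuous_intros)+
      ultimately show ?thesis by (simp add: measure_marks)
    qed
    then show ?thesis using AB by (simp add: intensity_integral)
  qed
  also have "\<dots> = intensity A + intensity B - intensity (A \<inter> B)"
    unfolding intensity_def using AB'
    by (intro measure_Un3 fmeasurableI) (simp_all add: eA eB)
  also have "intensity A = pi * R_I\<^sup>2"
    by (simp add: intensity_def measure_def eA)
  also have "intensity B = pi * r_I\<^sup>2"
    by (simp add: intensity_def measure_def eB)
  also have "intensity (A \<inter> B) = pi * overlap_integral R_I R_p r_I"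
  proof -
    have "measure marks {u. (t, u) \<in> A \<inter> B}
        = indicator (cball x R_I) t * (disk_overlap (norm (x - t)) R_p r_I / (pi * R_p\<^sup>2))" for t
      by (cases "dist x t \<le> R_I") (simp_all add: A_def B_def measure_marks_shifted_disk)
    then show ?thesis
      using overlap_integral_eq[OF R_I, of x r_I]
      by (simp only: intensity_integral[OF sets.Int[OF AB]])
  qed
  finally show ?thesis by (simp add: algebra_simps)
qed

end

section \<open>The occupied probability\<close>

lemma square_eq_cbox:
  "square r_p s = cbox (site_center r_p s - (side_length r_p / 2) *\<^sub>R 1) (site_center r_p s + (side_length r_p / 2) *\<^sub>R 1)"
  unfolding square_def abs_diff_le_iff by (simp add: mem_box_cart set_eq_iff)

lemma square_sets [measurable]: "square r_p s \<in> sets borel"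
  and bounded_square: "bounded (square r_p s)"
  by (simp_all add: square_eq_cbox)

text \<open>Origin of the \<open>8\<close> in the first factor: it is the square of
  \<open>2 * sqrt 2\<close>, the divisor in \<open>side_length\<close>.\<close>

lemma measure_square:
  assumes "0 \<le> r_p"
  shows "measure lborel (square r_p s) = r_p\<^sup>2 / 8"
proof -
  have d: "0 \<le> side_length r_p" "(side_length r_p)\<^sup>2 = r_p\<^sup>2 / 8"
    using assms by (auto simp: side_length_def power_divide power_mult_distrib)
  have "measure lborel (square r_p s) = (\<Prod>k\<in>(UNIV :: 2 set). side_length r_p)"
    unfolding square_eq_cbox using d(1)
    by (subst content_cbox_cart) (auto simp: interval_eq_empty_cart not_less)
  then show ?thesis using d(2) by simp
qed

context network_model begin

text \<open>The two almost sure properties behind the pathwise arguments: finitely many transmitters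
  nearby leave a positive margin to the exclusion radii, and the bound on the offsets identifies
  \<open>blocking\<close> with the actual denial of an opportunity.\<close>

lemma AE_network:
  "AE \<omega> in M. (\<forall>A. bounded A \<longrightarrow> finite {i \<in> indices T \<omega>. snd T i \<omega> \<in> A}) \<and>
     (\<forall>i. dist 0 (rx_offset net i \<omega>) \<le> R_p)"
proof -
  have "AE u in marks. dist 0 u \<le> R_p"
    by (rule AE_uniform_measureI) (auto simp: dist_norm)
  then have "AE u in distr M borel (rx_offset net i). dist 0 u \<le> R_p" for i
    by (simp only: distr_rx_offset)
  then have "AE \<omega> in M. dist 0 (rx_offset net i \<omega>) \<le> R_p" for i
    by (rule AE_distrD[rotated]) simp
  then have "AE \<omega> in M. \<forall>i. dist 0 (rx_offset net i \<omega>) \<le> R_p"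
    by (simp only: AE_all_countable) simp
  moreover have "AE \<omega> in M. \<forall>A. bounded A \<longrightarrow> finite {i \<in> indices T \<omega>. snd T i \<omega> \<in> A}"
    using PPP_T unfolding homogeneous_PPP_def by blast
  ultimately show ?thesis by eventually_elim auto
qed

lemma sees_opportunity_iff:
  assumes "\<And>i. dist 0 (rx_offset net i \<omega>) \<le> R_p"
  shows "sees_opportunity R_I r_I net \<omega> x \<longleftrightarrow> marked_void net (blocking R_I r_I x) \<omega>"
  using assms by (auto simp: sees_opportunity_def marked_void_def blocking_def rx_offset_def)

lemma marked_void_events:
  assumes K: "K \<in> sets borel"
  shows "{\<omega>\<in>space M. marked_void net K \<omega>} \<in> sets M"
proof -
  have [measurable]: "K \<in> sets (borel \<Otimes>\<^sub>M borel)" by (subst borel_prod) (rule K)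
  show ?thesis unfolding marked_void_def indices_def Ball_def mem_Collect_eq by measurable
qed

text \<open>A blocking receiver lies within \<open>r_I\<close> and its transmitter at most
  \<open>R_p\<close> further away; adding \<open>R_I\<close> also covers the case of a blocking
  transmitter.\<close>

lemma blocking_near:
  assumes "0 \<le> R_I" "0 \<le> r_I" "(t, u) \<in> blocking R_I r_I x"
  shows "dist x t \<le> R_I + r_I + R_p"
proof -
  have "dist x t \<le> dist x (t + u) + dist 0 u"
    using dist_triangle[of x t "t + u"] by (simp add: dist_norm)
  then show ?thesis using assms R_p by (auto simp: blocking_def)
qed

lemma prob_sees_opportunity:
  assumes R_I: "0 \<le> R_I" and r_I: "0 \<le> r_I"
  shows "measure M {\<omega>\<in>space M. sees_opportunity R_I r_I net \<omega> x}
    = exp (- (l_PT * (pi * (R_I\<^sup>2 + r_I\<^sup>2 - overlap_integral R_I R_p r_I))))"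
proof -
  have "measure M {\<omega>\<in>space M. sees_opportunity R_I r_I net \<omega> x} = measure M {\<omega>\<in>space M. marked_void net (blocking R_I r_I x) \<omega>}"
  proof (rule measure_eq_AE)
    show "AE \<omega> in M. \<omega> \<in> {\<omega>\<in>space M. sees_opportunity R_I r_I net \<omega> x} \<longleftrightarrow> \<omega> \<in> {\<omega>\<in>space M. marked_void net (blocking R_I r_I x) \<omega>}"
      using AE_network by eventually_elim (simp add: sees_opportunity_iff)
    show "{\<omega>\<in>space M. sees_opportunity R_I r_I net \<omega> x} \<in> sets M"
      unfolding sees_opportunity_def indices_def Ball_def mem_Collect_eq by measurable
  qed (simp add: marked_void_events)
  also have "\<dots> = exp (- (l_PT * intensity (blocking R_I r_I x)))"
  proof (rule marked_void_prob)
    show "blocking R_I r_I x \<subseteq> cball x (R_I + r_I + R_p) \<times> UNIV"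
      using blocking_near[OF assms] by auto
  qed auto
  finally show ?thesis by (simp add: intensity_blocking assms)
qed

text \<open>An event on configurations (users, transmitters, receivers) rather than on outcomes, so
  that the users and the primary network can be taken from different outcomes.\<close>

definition occupation :: "real \<Rightarrow> real \<Rightarrow> plane set \<Rightarrow>
    ((enat \<times> (nat \<Rightarrow> plane)) \<times> (enat \<times> (nat \<Rightarrow> plane)) \<times> (nat \<Rightarrow> plane)) set" where
  "occupation R_I r_I A =
     {q \<in> space (enumeration_space \<Otimes>\<^sub>M (enumeration_space \<Otimes>\<^sub>M (\<Pi>\<^sub>M i\<in>UNIV. borel))).
       \<exists>i. enat i < fst (fst q) \<and> snd (fst q) i \<in> A \<and>
         (\<forall>j. enat j < fst (fst (snd q)) \<longrightarrow>
            \<not> dist (snd (fst q) i) (snd (fst (snd q)) j) \<le> R_I \<and> \<not> dist (snd (fst q) i) (snd (snd q) j) \<le> r_I)}"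

lemma occupation_sets:
  assumes [measurable]: "A \<in> sets borel"
  shows "occupation R_I r_I A \<in> sets (enumeration_space \<Otimes>\<^sub>M (enumeration_space \<Otimes>\<^sub>M (\<Pi>\<^sub>M i\<in>UNIV. borel)))"
  unfolding occupation_def by measurable

lemma occupation_iff:
  assumes "\<omega> \<in> space M" "\<omega>' \<in> space M"
  shows "(enumeration S \<omega>, enumeration T \<omega>', \<lambda>i. rx net i \<omega>') \<in> occupation R_I r_I A
    \<longleftrightarrow> (\<exists>x\<in>points S \<omega>. x \<in> A \<and> sees_opportunity R_I r_I net \<omega>' x)"
proof -
  have "enumeration S \<omega> \<in> space enumeration_space" "enumeration T \<omega>' \<in> space enumeration_space"
    using assms measurable_space[OF measurable_network(1)] measurable_space[OF measurable_network(2)] by blast+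
  then show ?thesis
    unfolding occupation_def enumeration_def points_def indices_def sees_opportunity_def
    by (simp add: space_pair_measure space_PiM Ball_def)
qed

lemma measurable_rx [measurable]: "(\<lambda>\<omega> i. rx net i \<omega>) \<in> measurable M (\<Pi>\<^sub>M i\<in>UNIV. borel)"
  by (rule measurable_abs_UNIV) simp

text \<open>
  Conditionally on a secondary process with a point \<open>x\<close> in the square, the site is occupied with at
  least the probability that \<open>x\<close> sees an opportunity, which does not depend on \<open>x\<close>.
\<close>

lemma occupied_prob_lower_bound:
  assumes R_I: "0 \<le> R_I" and r_I: "0 \<le> r_I" and r_p: "0 \<le> r_p"
  shows "(1 - exp (- (l_S * r_p\<^sup>2 / 8))) *
     exp (- (l_PT * (pi * (R_I\<^sup>2 + r_I\<^sup>2 - overlap_integral R_I R_p r_I)))) \<le> occupied_prob R_I r_p r_I net"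
proof -
  interpret prob_space M by (rule prob_space_M)
  let ?A = "square r_p (0, 0)"
  let ?Q = "occupation R_I r_I ?A"
  let ?Y = "\<lambda>\<omega>. (enumeration T \<omega>, \<lambda>i. rx net i \<omega>)"
  define c where "c = exp (- (l_PT * (pi * (R_I\<^sup>2 + r_I\<^sup>2 - overlap_integral R_I R_p r_I))))"
  define N where "N = {\<omega>\<in>space M. void S ?A \<omega>}"
  have N[measurable]: "N \<in> sets M"
    unfolding N_def void_def indices_def Ball_def mem_Collect_eq by measurable
  have "emeasure M {\<omega>\<in>space M. occupied R_I r_p r_I net \<omega> (0, 0)} = emeasure M {\<omega>\<in>space M. (enumeration S \<omega>, ?Y \<omega>) \<in> ?Q}"
    by (intro arg_cong[where f="emeasure M"] Collect_cong conj_cong refl) (simp only: occupation_iff occupied_def)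
  also have "\<dots> = (\<integral>\<^sup>+\<omega>. emeasure M {\<omega>'\<in>space M. (enumeration S \<omega>, ?Y \<omega>') \<in> ?Q} \<partial>M)"
    by (rule emeasure_indep_elements[OF prob_space_M indep_S occupation_sets[OF square_sets]])
  finally have occ: "emeasure M {\<omega>\<in>space M. occupied R_I r_p r_I net \<omega> (0, 0)}
    = (\<integral>\<^sup>+\<omega>. emeasure M {\<omega>'\<in>space M. (enumeration S \<omega>, ?Y \<omega>') \<in> ?Q} \<partial>M)" .
  have "ennreal (c * prob (space M - N)) = (\<integral>\<^sup>+\<omega>. ennreal c * indicator (space M - N) \<omega> \<partial>M)"
    by (simp add: emeasure_eq_measure ennreal_mult' nn_integral_cmult_indicator c_def)
  also have "\<dots> \<le> (\<integral>\<^sup>+\<omega>. emeasure M {\<omega>'\<in>space M. (enumeration S \<omega>, ?Y \<omega>') \<in> ?Q} \<partial>M)"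
  proof (rule nn_integral_mono)
    fix \<omega> assume \<omega>: "\<omega> \<in> space M"
    show "ennreal c * indicator (space M - N) \<omega> \<le> emeasure M {\<omega>'\<in>space M. (enumeration S \<omega>, ?Y \<omega>') \<in> ?Q}"
    proof (cases "\<omega> \<in> N")
      case False
      \<comment> \<open>Any user in the square will do: \<open>x\<close> only serves to bound the
        integrand at this \<open>\<omega>\<close>, so it need not depend measurably on
        \<open>\<omega>\<close>.\<close>
      with \<omega> obtain x where x: "x \<in> points S \<omega>" "x \<in> ?A"
        by (auto simp: N_def void_def points_def)
      have "ennreal c = emeasure M {\<omega>'\<in>space M. sees_opportunity R_I r_I net \<omega>' x}"
        unfolding c_def emeasure_eq_measure prob_sees_opportunity[OF R_I r_I] ..
      also have "\<dots> \<le> emeasure M {\<omega>'\<in>space M. (enumeration S \<omega>, ?Y \<omega>') \<in> ?Q}"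
      proof (rule emeasure_mono)
        show "{\<omega>'\<in>space M. sees_opportunity R_I r_I net \<omega>' x} \<subseteq> {\<omega>'\<in>space M. (enumeration S \<omega>, ?Y \<omega>') \<in> ?Q}"
          using x \<omega> by (auto simp: occupation_iff)
        have "Pair (enumeration S \<omega>) -` ?Q \<in> sets (enumeration_space \<Otimes>\<^sub>M (\<Pi>\<^sub>M i\<in>UNIV. borel))"
          by (rule sets_Pair1[OF occupation_sets[OF square_sets]])
        moreover have "?Y \<in> measurable M (enumeration_space \<Otimes>\<^sub>M (\<Pi>\<^sub>M i\<in>UNIV. borel))" by measurable
        ultimately have "?Y -` (Pair (enumeration S \<omega>) -` ?Q) \<inter> space M \<in> sets M"
          by (rule measurable_sets[rotated])
        then show "{\<omega>'\<in>space M. (enumeration S \<omega>, ?Y \<omega>') \<in> ?Q} \<in> sets M"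
          by (simp add: vimage_def Int_def conj_commute)
      qed
      finally show ?thesis by (simp add: indicator_def)
    qed simp
  qed
  also have "\<dots> = ennreal (occupied_prob R_I r_p r_I net)"
    by (simp only: occ[symmetric]) (simp only: emeasure_eq_measure occupied_prob_def)
  finally have "c * prob (space M - N) \<le> occupied_prob R_I r_p r_I net"
    by (subst (asm) ennreal_le_iff) (auto simp: occupied_prob_def)
  moreover have "prob (space M - N) = 1 - exp (- (l_S * r_p\<^sup>2 / 8))"
    using PPP_void_prob[OF prob_space_M PPP_S square_sets bounded_square, of r_p "(0, 0)"]
    by (simp add: prob_compl measure_square[OF r_p] N_def[symmetric])
  ultimately show ?thesis by (simp add: c_def mult.commute)
qed

end

section \<open>A zero-one law for percolation\<close>

lemma finite_squares_meeting_ball: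
  assumes r_p: "0 < r_p"
  shows "finite {s. \<exists>x\<in>square r_p s. norm x < R}"
proof -
  define d where "d = side_length r_p"
  have d: "0 < d" using r_p by (simp add: d_def side_length_def)
  \<comment> \<open>A coordinate of a point, divided by \<open>d\<close>, differs by at most
    \<open>1 / 2\<close> from the index of a square containing it.\<close>
  define m where "m = \<lceil>R / d + 1 / 2\<rceil>"
  have bound: "i \<in> {-m..m}" if "\<bar>y - d * of_int i\<bar> \<le> d / 2" "\<bar>y\<bar> < R" for y i
  proof -
    have "\<bar>d * of_int i\<bar> \<le> R + d / 2" using that by linarith
    then have "d * \<bar>of_int i\<bar> \<le> R + d / 2" using d by (simp add: abs_mult)
    then have "\<bar>of_int i\<bar> \<le> R / d + 1 / 2" using d by (simp add: field_simps)
    then have "\<bar>i\<bar> \<le> m" unfolding m_def by linarith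
    then show ?thesis by auto
  qed
  have "{s. \<exists>x\<in>square r_p s. norm x < R} \<subseteq> {-m..m} \<times> {-m..m}"
  proof clarify
    fix i j x assume x: "x \<in> square r_p (i, j)" "norm x < R"
    have "\<bar>x $ k\<bar> < R" for k
      using component_le_norm_cart[of x k] x(2) by linarith
    moreover have "\<bar>x $ 1 - d * of_int i\<bar> \<le> d / 2" "\<bar>x $ 2 - d * of_int j\<bar> \<le> d / 2"
      using x(1) by (auto simp: square_def site_center_def d_def forall_2)
    ultimately show "i \<in> {-m..m} \<and> j \<in> {-m..m}" using bound by blast
  qed
  then show ?thesis by (rule finite_subset) simp
qed

lemma finite_squares_containing:
  "0 < r_p \<Longrightarrow> finite {s. x \<in> square r_p s}"
  by (rule finite_subset[OF _ finite_squares_meeting_ball[of r_p "norm x + 1"]]) (auto intro!: bexI[of _ x])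

lemma finite_neighbors:
  assumes "0 < r_p"
  shows "finite {t. neighbors r_p s t}"
proof -
  obtain R where "\<And>x. x \<in> square r_p s \<Longrightarrow> norm x < R"
    using bounded_square[of r_p s] unfolding bounded_pos_less by blast
  then have "{t. neighbors r_p s t} \<subseteq> {t. \<exists>x\<in>square r_p t. norm x < R}"
    by (auto simp: neighbors_def)
  then show ?thesis
    using finite_squares_meeting_ball[OF assms] by (rule finite_subset)
qed

text \<open>Everything reduces to countable operations: reachability is a union over path lengths,
  and a set is infinite iff each of the countably many finite sets \<open>F\<close> misses one of
  its elements.\<close>

lemma pred_in_infinite_component:
  fixes V :: "'a \<Rightarrow> 'v::countable set"
  assumes V[measurable]: "\<And>v. Measurable.pred N (\<lambda>\<omega>. v \<in> V \<omega>)"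
  shows "Measurable.pred N (\<lambda>\<omega>. in_infinite_component (V \<omega>) E x)"
proof -
  let ?R = "\<lambda>\<omega> a b. a \<in> V \<omega> \<and> b \<in> V \<omega> \<and> E a b"
  have pow: "Measurable.pred N (\<lambda>\<omega>. (?R \<omega> ^^ n) x y)" for n y
  proof (induction n arbitrary: y)
    case (Suc n)
    note Suc[measurable]
    show ?case unfolding relpowp.simps relcompp_apply by measurable
  qed simp
  have "infinite A \<longleftrightarrow> (\<forall>F\<in>{F. finite F}. \<exists>y. y \<notin> F \<and> y \<in> A)" for A :: "'v set"
    using finite_subset[of A] by (auto simp: subset_eq)
  then have *: "in_infinite_component (V \<omega>) E x \<longleftrightarrow>
      x \<in> V \<omega> \<and> (\<forall>F\<in>{F. finite F}. \<exists>y. y \<notin> F \<and> (\<exists>n. (?R \<omega> ^^ n) x y))" for \<omega>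
    unfolding in_infinite_component_def rtranclp_power by simp
  have "countable {F :: 'v set. finite F}"
    by (rule countable_Collect_finite)
  then show ?thesis
    unfolding * using pow by measurable
qed

section \<open>Independence of the configurations in disjoint annuli\<close>

definition annulus :: "nat \<Rightarrow> plane set" where
  "annulus n = {x. real n \<le> norm x \<and> norm x < real (Suc n)}"

lemma annulus_sets [measurable]: "annulus n \<in> sets borel"
  unfolding annulus_def by measurable

lemma bounded_annulus: "bounded (annulus n)"
  by (rule bounded_subset[OF bounded_cball[of 0 "real (Suc n)"]]) (auto simp: annulus_def)

lemma disjoint_annulus: "m \<noteq> n \<Longrightarrow> annulus m \<inter> annulus n = {}"
  by (auto simp: annulus_def)

lemma mem_annulus_floor: "x \<in> annulus (nat \<lfloor>norm x\<rfloor>)"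
  unfolding annulus_def mem_Collect_eq by (simp add: of_nat_nat) linarith

context network_model begin

lemma void_events_S:
  assumes [measurable]: "A \<in> sets borel"
  shows "{\<omega>\<in>space M. void S A \<omega>} \<in> sets M"
  unfolding void_def indices_def Ball_def mem_Collect_eq by measurable

lemma joint_void_prob:
  assumes A: "A \<in> sets borel" "bounded A" and K: "K \<in> sets borel" "B \<in> sets borel" "bounded B" "K \<subseteq> B \<times> UNIV"
  shows "measure M {\<omega>\<in>space M. void S A \<omega> \<and> marked_void net K \<omega>}
    = exp (- (l_S * measure lborel A)) * exp (- (l_PT * intensity K))"
proof -
  have [measurable]: "K \<in> sets (borel \<Otimes>\<^sub>M borel)" by (subst borel_prod) (rule K)
  let ?A = "{e \<in> space enumeration_space. \<forall>i. enat i < fst e \<longrightarrow> snd e i \<notin> A}"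
  let ?N = "enumeration_space \<Otimes>\<^sub>M (\<Pi>\<^sub>M i\<in>UNIV. borel :: plane measure)"
  \<comment> \<open>Independence from the users is granted for the receivers, so the offset is
    recovered as receiver minus transmitter.\<close>
  let ?K = "{q \<in> space ?N. \<forall>i. enat i < fst (fst q) \<longrightarrow> (snd (fst q) i, snd q i - snd (fst q) i) \<notin> K}"
  let ?Y = "\<lambda>\<omega>. (enumeration T \<omega>, \<lambda>i. rx net i \<omega>)"
  have E: "enumeration S \<omega> \<in> space enumeration_space" "enumeration T \<omega> \<in> space enumeration_space" if "\<omega> \<in> space M" for \<omega>
    using that measurable_space[OF measurable_network(1)] measurable_space[OF measurable_network(2)] by blast+
  have S: "enumeration S \<omega> \<in> ?A \<longleftrightarrow> void S A \<omega>" if "\<omega> \<in> space M" for \<omega>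
    using E[OF that] by (simp add: void_iff)
  have K_iff: "?Y \<omega> \<in> ?K \<longleftrightarrow> marked_void net K \<omega>" if "\<omega> \<in> space M" for \<omega>
    using E[OF that]
    by (simp add: space_pair_measure space_PiM marked_void_def indices_def enumeration_def rx_offset_def Ball_def)
  have "?K \<in> sets ?N" by measurable
  then have "measure M {\<omega>\<in>space M. enumeration S \<omega> \<in> ?A \<and> ?Y \<omega> \<in> ?K}
      = measure M {\<omega>\<in>space M. enumeration S \<omega> \<in> ?A} * measure M {\<omega>\<in>space M. ?Y \<omega> \<in> ?K}"
    by (intro prob_indep_elements[OF prob_space_M indep_S] void_set A)
  also have "{\<omega>\<in>space M. enumeration S \<omega> \<in> ?A \<and> ?Y \<omega> \<in> ?K} = {\<omega>\<in>space M. void S A \<omega> \<and> marked_void net K \<omega>}"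
    by (intro Collect_cong conj_cong refl S K_iff)
  also have "{\<omega>\<in>space M. enumeration S \<omega> \<in> ?A} = {\<omega>\<in>space M. void S A \<omega>}"
    by (intro Collect_cong conj_cong refl S)
  also have "{\<omega>\<in>space M. ?Y \<omega> \<in> ?K} = {\<omega>\<in>space M. marked_void net K \<omega>}"
    by (intro Collect_cong conj_cong refl K_iff)
  finally show ?thesis
    by (simp only: PPP_void_prob[OF prob_space_M PPP_S A] marked_void_prob[OF K])
qed

text \<open>
  Void events are closed under intersection, since the regions are then united; hence independence
  of the generated \<open>\<sigma>\<close>-algebras follows from the product formula for void probabilities.
\<close>

definition void_family :: "nat \<Rightarrow> 'w set set" where
  "void_family n = {{\<omega>\<in>space M. void S A \<omega> \<and> marked_void net K \<omega>} | A K.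
     A \<in> sets borel \<and> A \<subseteq> annulus n \<and> K \<in> sets borel \<and> K \<subseteq> annulus n \<times> UNIV}"

lemma void_familyI:
  "A \<in> sets borel \<Longrightarrow> A \<subseteq> annulus n \<Longrightarrow> K \<in> sets borel \<Longrightarrow> K \<subseteq> annulus n \<times> UNIV \<Longrightarrow>
   {\<omega>\<in>space M. void S A \<omega> \<and> marked_void net K \<omega>} \<in> void_family n"
  unfolding void_family_def by blast

lemma void_family_events: "void_family n \<subseteq> sets M"
  unfolding void_family_def
  by (auto intro!: sets.sets_Collect_conj void_events_S marked_void_events)

lemma Int_stable_void_family: "Int_stable (void_family n)"
proof (rule Int_stableI)
  fix X Y assume "X \<in> void_family n" "Y \<in> void_family n"
  then obtain A K A' K' where
    X: "X = {\<omega>\<in>space M. void S A \<omega> \<and> marked_void net K \<omega>}" "A \<in> sets borel" "A \<subseteq> annulus n" "K \<in> sets borel" "K \<subseteq> annulus n \<times> UNIV" and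
    Y: "Y = {\<omega>\<in>space M. void S A' \<omega> \<and> marked_void net K' \<omega>}" "A' \<in> sets borel" "A' \<subseteq> annulus n" "K' \<in> sets borel" "K' \<subseteq> annulus n \<times> UNIV"
    unfolding void_family_def by blast
  have "X \<inter> Y = {\<omega>\<in>space M. void S (A \<union> A') \<omega> \<and> marked_void net (K \<union> K') \<omega>}"
    unfolding X Y void_def marked_void_def by blast
  also have "\<dots> \<in> void_family n"
    using X Y by (intro void_familyI) auto
  finally show "X \<inter> Y \<in> void_family n" .
qed

text \<open>The marks have total mass 1, so the area of the bounded set of positions is a bound even
  if the offsets in \<open>K\<close> are unbounded.\<close>

lemma emeasure_marked_finite:
  assumes "A \<in> sets borel" "bounded A" "K \<subseteq> A \<times> UNIV"
  shows "emeasure (lborel \<Otimes>\<^sub>M marks) K \<noteq> \<infinity>"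
proof -
  interpret marks: prob_space marks by (rule prob_space_marks)
  have "emeasure (lborel \<Otimes>\<^sub>M marks) K \<le> emeasure (lborel \<Otimes>\<^sub>M marks) (A \<times> space marks)"
    using assms by (intro emeasure_mono) auto
  also have "\<dots> = emeasure lborel A"
    using assms marks.emeasure_space_1 by (subst marks.emeasure_pair_measure_Times) auto
  also have "\<dots> < \<infinity>" using assms(2) by (rule emeasure_bounded_finite)
  finally show ?thesis by simp
qed

text \<open>The regions for different \<open>j\<close> lie over disjoint annuli, so both masses add
  up over \<open>J\<close> and the exponential turns the sums into products. The position of the
  transmitter alone separates the sets \<open>K j\<close>; a receiver may lie in another
  annulus.\<close>

lemma indep_void_family: "prob_space.indep_sets M void_family UNIV"
proof -
  interpret prob_space M by (rule prob_space_M)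
  show ?thesis
  proof (rule indep_setsI)
    show "void_family n \<subseteq> events" for n by (rule void_family_events)
  next
    fix X J assume J: "J \<noteq> {}" "finite J" and X: "\<forall>j\<in>J. X j \<in> void_family j"
    let ?P = "\<lambda>j (A, K). X j = {\<omega>\<in>space M. void S A \<omega> \<and> marked_void net K \<omega>} \<and>
       A \<in> sets borel \<and> A \<subseteq> annulus j \<and> K \<in> sets borel \<and> K \<subseteq> annulus j \<times> UNIV"
    have "\<forall>j\<in>J. \<exists>p. ?P j p"
      using X unfolding void_family_def by (auto 4 3)
    from bchoice[OF this] obtain p where p: "\<forall>j\<in>J. ?P j (p j)" ..
    define A K where "A j = fst (p j)" and "K j = snd (p j)" for j
    have AK: "X j = {\<omega>\<in>space M. void S (A j) \<omega> \<and> marked_void net (K j) \<omega>}"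
       "A j \<in> sets borel" "A j \<subseteq> annulus j" "K j \<in> sets borel" "K j \<subseteq> annulus j \<times> UNIV" if "j \<in> J" for j
      using bspec[OF p that] by (simp_all add: A_def K_def case_prod_beta)
    have bA: "bounded (A j)" if "j \<in> J" for j
      by (rule bounded_subset[OF bounded_annulus AK(3)[OF that]])
    have "(\<Inter>j\<in>J. X j) = (\<Inter>j\<in>J. {\<omega>\<in>space M. void S (A j) \<omega> \<and> marked_void net (K j) \<omega>})"
      using AK(1) by simp
    also have "\<dots> = {\<omega>\<in>space M. void S (\<Union>j\<in>J. A j) \<omega> \<and> marked_void net (\<Union>j\<in>J. K j) \<omega>}"
      using J(1) unfolding void_def marked_void_def by blast
    finally have "prob (\<Inter>j\<in>J. X j) = prob {\<omega>\<in>space M. void S (\<Union>j\<in>J. A j) \<omega> \<and> marked_void net (\<Union>j\<in>J. K j) \<omega>}"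
      by simp
    also have "\<dots> = exp (- (l_S * measure lborel (\<Union>j\<in>J. A j))) * exp (- (l_PT * intensity (\<Union>j\<in>J. K j)))"
    proof (rule joint_void_prob)
      show "(\<Union>j\<in>J. K j) \<subseteq> (\<Union>j\<in>J. annulus j) \<times> UNIV" using AK(5) by blast
      show "bounded (\<Union>j\<in>J. A j)" "bounded (\<Union>j\<in>J. annulus j)"
        using J(2) bA bounded_annulus by auto
      show "(\<Union>j\<in>J. A j) \<in> sets borel" "(\<Union>j\<in>J. K j) \<in> sets borel" "(\<Union>j\<in>J. annulus j) \<in> sets borel"
        using J(2) AK(2,4) by (auto intro!: sets.finite_UN)
    qed
    also have "measure lborel (\<Union>j\<in>J. A j) = (\<Sum>j\<in>J. measure lborel (A j))"
    proof (rule measure_finite_Union[OF J(2)])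
      show "disjoint_family_on A J"
        using AK(3) disjoint_annulus unfolding disjoint_family_on_def by blast
      show "emeasure lborel (A j) \<noteq> \<infinity>" if "j \<in> J" for j
        using emeasure_bounded_finite[OF bA[OF that]] by simp
    qed (use AK(2) in auto)
    also have "intensity (\<Union>j\<in>J. K j) = (\<Sum>j\<in>J. intensity (K j))"
      unfolding intensity_def
    proof (rule measure_finite_Union[OF J(2)])
      show "disjoint_family_on K J"
        using AK(5) disjoint_annulus unfolding disjoint_family_on_def by blast
      show "emeasure (lborel \<Otimes>\<^sub>M marks) (K j) \<noteq> \<infinity>" if "j \<in> J" for j
        by (rule emeasure_marked_finite[OF annulus_sets bounded_annulus AK(5)[OF that]])
      have "sets (lborel \<Otimes>\<^sub>M marks) = sets (borel :: (plane \<times> plane) measure)"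
        unfolding borel_prod[symmetric] by (rule sets_pair_measure_cong) auto
      then show "K ` J \<subseteq> sets (lborel \<Otimes>\<^sub>M marks)" using AK(4) by blast
    qed
    also have "exp (- (l_S * (\<Sum>j\<in>J. measure lborel (A j)))) * exp (- (l_PT * (\<Sum>j\<in>J. intensity (K j))))
        = (\<Prod>j\<in>J. exp (- (l_S * measure lborel (A j))) * exp (- (l_PT * intensity (K j))))"
      using J(2) by (simp add: sum_distrib_left sum_negf[symmetric] exp_sum prod.distrib)
    also have "\<dots> = (\<Prod>j\<in>J. prob (X j))"
      by (intro prod.cong refl)
         (simp add: AK(1) joint_void_prob[OF AK(2) bA AK(4) annulus_sets bounded_annulus AK(5)])
    finally show "prob (\<Inter>j\<in>J. X j) = (\<Prod>j\<in>J. prob (X j))" .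
  qed
qed

text \<open>The sigma-algebra is wrapped as a \<open>measure\<close> so that
  \<open>Measurable.pred\<close> and its rules apply. An event that lies in it for every
  \<open>n\<close> is a tail event in the sense of Kolmogorov's law.\<close>

definition tail_algebra :: "nat \<Rightarrow> 'w measure" where
  "tail_algebra n = sigma (space M) (\<Union>m\<in>{n..}. sigma_sets (space M) (void_family m))"

lemma space_tail_algebra: "space (tail_algebra n) = space M"
  and sets_tail_algebra: "sets (tail_algebra n) = sigma_sets (space M) (\<Union>m\<in>{n..}. sigma_sets (space M) (void_family m))"
proof -
  have "(\<Union>m\<in>{n..}. sigma_sets (space M) (void_family m)) \<subseteq> Pow (space M)"
    using sigma_sets_into_sp[of "void_family _" "space M"] by (auto simp: void_family_def)
  then show "space (tail_algebra n) = space M"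
    "sets (tail_algebra n) = sigma_sets (space M) (\<Union>m\<in>{n..}. sigma_sets (space M) (void_family m))"
    unfolding tail_algebra_def by (auto simp: space_measure_of sets_measure_of)
qed

lemma pred_void_family:
  assumes "n \<le> m" "A \<in> sets borel" "A \<subseteq> annulus m" "K \<in> sets borel" "K \<subseteq> annulus m \<times> UNIV"
  shows "Measurable.pred (tail_algebra n) (\<lambda>\<omega>. void S A \<omega> \<and> marked_void net K \<omega>)"
  unfolding pred_def space_tail_algebra sets_tail_algebra
  using assms by (intro sigma_sets.Basic UN_I[of m] void_familyI) auto

text \<open>The set \<open>A\<close> may be unbounded, but it is the countable union of its parts in
  the annuli. The annulus of a point \<open>x\<close> has index
  \<open>nat \<lfloor>norm x\<rfloor>\<close>, which is at least \<open>n\<close> on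
  \<open>A\<close>. Taking \<open>{}\<close> as marked region leaves a pure void event.\<close>

lemma pred_tail_void:
  assumes A: "A \<in> sets borel" "\<And>x. x \<in> A \<Longrightarrow> real n \<le> norm x"
  shows "Measurable.pred (tail_algebra n) (void S A)"
proof -
  have [measurable]: "Measurable.pred (tail_algebra n) (void S (A \<inter> annulus m))" if "m \<in> {n..}" for m
    using pred_void_family[of n m "A \<inter> annulus m" "{}"] that A(1) by (simp add: marked_void_def)
  have "void S A \<omega> \<longleftrightarrow> (\<forall>m\<in>{n..}. void S (A \<inter> annulus m) \<omega>)" for \<omega>
  proof
    assume *: "\<forall>m\<in>{n..}. void S (A \<inter> annulus m) \<omega>"
    show "void S A \<omega>"
      unfolding void_def
    proof (intro ballI notI)
      fix i assume i: "i \<in> indices S \<omega>" "snd S i \<omega> \<in> A"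
      have "n \<le> nat \<lfloor>norm (snd S i \<omega>)\<rfloor>"
        using A(2)[OF i(2)] by (simp add: le_nat_floor)
      then show False
        using * i mem_annulus_floor[of "snd S i \<omega>"] unfolding void_def by blast
    qed
  qed (auto simp: void_def)
  then have "void S A = (\<lambda>\<omega>. \<forall>m\<in>{n..}. void S (A \<inter> annulus m) \<omega>)" by (rule ext)
  then show ?thesis by simp
qed

lemma pred_tail_marked_void:
  assumes K: "K \<in> sets borel" "\<And>t u. (t, u) \<in> K \<Longrightarrow> real n \<le> norm t"
  shows "Measurable.pred (tail_algebra n) (marked_void net K)"
proof -
  have [measurable]: "Measurable.pred (tail_algebra n) (marked_void net (K \<inter> annulus m \<times> UNIV))" if "m \<in> {n..}" for m
  proof -
    have "annulus m \<times> UNIV \<in> sets (borel :: (plane \<times> plane) measure)"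
      unfolding borel_prod[symmetric] by measurable
    then show ?thesis
      using pred_void_family[of n m "{}" "K \<inter> annulus m \<times> UNIV"] that K(1) by (simp add: void_def)
  qed
  have "marked_void net K \<omega> \<longleftrightarrow> (\<forall>m\<in>{n..}. marked_void net (K \<inter> annulus m \<times> UNIV) \<omega>)" for \<omega>
  proof
    assume *: "\<forall>m\<in>{n..}. marked_void net (K \<inter> annulus m \<times> UNIV) \<omega>"
    show "marked_void net K \<omega>"
      unfolding marked_void_def
    proof (intro ballI notI)
      fix i assume i: "i \<in> indices T \<omega>" "(snd T i \<omega>, rx_offset net i \<omega>) \<in> K"
      have "n \<le> nat \<lfloor>norm (snd T i \<omega>)\<rfloor>"
        using K(2)[OF i(2)] by (simp add: le_nat_floor)
      then show False
        using * i mem_annulus_floor[of "snd T i \<omega>"] unfolding marked_void_def by blast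
    qed
  qed (auto simp: marked_void_def)
  then have "marked_void net K = (\<lambda>\<omega>. \<forall>m\<in>{n..}. marked_void net (K \<inter> annulus m \<times> UNIV) \<omega>)" by (rule ext)
  then show ?thesis by simp
qed

text \<open>
  Up to a null set this is \<^const>\<open>occupied\<close>, but written as a countable combination of void events,
  each of which involves only the points in a bounded region: a secondary user is located up to
  \<open>1 / Suc k\<close> by a point of the countable dense set \<open>D\<close>, and the exclusion radii are enlarged
  accordingly.
\<close>

definition approx_occupied :: "real \<Rightarrow> real \<Rightarrow> real \<Rightarrow> plane set \<Rightarrow> 'w \<Rightarrow> site \<Rightarrow> bool" where
  "approx_occupied R_I r_p r_I D \<omega> s \<longleftrightarrow>
     (\<exists>c\<in>D. \<exists>k::nat. \<not> void S (square r_p s \<inter> ball c (1 / Suc k)) \<omega> \<and>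
        marked_void net (blocking (R_I + 1 / Suc k) (r_I + 1 / Suc k) c) \<omega>)"

text \<open>The \<open>3\<close> in the distance is three errors of at most
  \<open>1 / Suc k\<close>: the displacement from a point of the square to \<open>c\<close>, and the
  enlargement of each exclusion radius. What remains is the reach of a blocking transmitter.\<close>

lemma pred_tail_approx_occupied:
  assumes R: "0 < R_I" "0 < r_I" and D: "countable D"
    and far: "\<And>x. x \<in> square r_p s \<Longrightarrow> real n + (R_I + r_I + R_p + 3) \<le> norm x"
  shows "Measurable.pred (tail_algebra n) (\<lambda>\<omega>. approx_occupied R_I r_p r_I D \<omega> s)"
proof -
  have "Measurable.pred (tail_algebra n) (\<lambda>\<omega>. \<not> void S (square r_p s \<inter> ball c (1 / Suc k)) \<omega> \<and>
          marked_void net (blocking (R_I + 1 / Suc k) (r_I + 1 / Suc k) c) \<omega>)" for c k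
  \<comment> \<open>A ball that misses the square makes the event impossible; otherwise
    \<open>c\<close> is close to the square and hence also far from the origin.\<close>
  proof (cases "square r_p s \<inter> ball c (1 / Suc k) = {}")
    case True
    then show ?thesis by (simp add: void_def)
  next
    case False
    then obtain x where x: "x \<in> square r_p s" "dist c x < 1 / Suc k" by auto
    have k: "0 < 1 / real (Suc k)" "1 / real (Suc k) \<le> 1" by auto
    have norm_diff: "norm y - norm z \<le> dist y z" for y z :: plane
      using norm_triangle_ineq2[of y z] by (simp add: dist_norm)
    have c: "real n + (R_I + r_I + R_p + 2) \<le> norm c"
      using far[OF x(1)] x(2) k norm_diff[of x c] by (simp only: dist_commute[of c x])
    have "real n \<le> norm t" if "(t, u) \<in> blocking (R_I + 1 / Suc k) (r_I + 1 / Suc k) c" for t u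
    proof -
      have "dist c t \<le> (R_I + 1 / Suc k) + (r_I + 1 / Suc k) + R_p"
        by (rule blocking_near[OF _ _ that]) (use R in auto)
      then show ?thesis using c k norm_diff[of c t] by linarith
    qed
    moreover have "real n \<le> norm y" if "y \<in> square r_p s" for y
      using far[OF that] R R_p by linarith
    ultimately show ?thesis
      by (intro pred_intros_logic pred_tail_void pred_tail_marked_void) auto
  qed
  then show ?thesis
    unfolding approx_occupied_def using D by measurable
qed

text \<open>Enlarged radii around a nearby \<open>c\<close> contain the original ones around the
  user, so the approximation is sufficient. Conversely, a user that sees an opportunity has only
  finitely many relevant transmitters and so keeps a positive margin, which leaves room for some
  \<open>c\<close> and \<open>k\<close>.\<close>

lemma occupied_iff_approx:
  assumes R: "0 < R_I" "0 < r_I"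
    and D: "\<And>X. open X \<Longrightarrow> X \<noteq> {} \<Longrightarrow> \<exists>d\<in>D. d \<in> X"
    and fin: "\<And>A. bounded A \<Longrightarrow> finite {i \<in> indices T \<omega>. snd T i \<omega> \<in> A}"
    and offset: "\<And>i. dist 0 (rx_offset net i \<omega>) \<le> R_p"
  shows "occupied R_I r_p r_I net \<omega> s \<longleftrightarrow> approx_occupied R_I r_p r_I D \<omega> s"
proof
  assume "approx_occupied R_I r_p r_I D \<omega> s"
  then obtain c k where c: "\<not> void S (square r_p s \<inter> ball c (1 / Suc k)) \<omega>"
    "marked_void net (blocking (R_I + 1 / Suc k) (r_I + 1 / Suc k) c) \<omega>"
    unfolding approx_occupied_def by blast
  then obtain i where i: "i \<in> indices S \<omega>" "snd S i \<omega> \<in> square r_p s" "dist c (snd S i \<omega>) < 1 / Suc k"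
    by (auto simp: void_def)
  have "blocking R_I r_I (snd S i \<omega>) \<subseteq> blocking (R_I + 1 / Suc k) (r_I + 1 / Suc k) c"
  proof clarify
    fix t u assume "(t, u) \<in> blocking R_I r_I (snd S i \<omega>)"
    moreover have "dist c t \<le> dist c (snd S i \<omega>) + dist (snd S i \<omega>) t"
      "dist c (t + u) \<le> dist c (snd S i \<omega>) + dist (snd S i \<omega>) (t + u)"
      by (rule dist_triangle)+
    ultimately show "(t, u) \<in> blocking (R_I + 1 / Suc k) (r_I + 1 / Suc k) c"
      using i(3) unfolding blocking_def by auto
  qed
  then have "marked_void net (blocking R_I r_I (snd S i \<omega>)) \<omega>"
    using c(2) unfolding marked_void_def by blast
  then show "occupied R_I r_p r_I net \<omega> s"
    using i unfolding occupied_def points_def sees_opportunity_iff[OF offset] by blast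
next
  assume "occupied R_I r_p r_I net \<omega> s"
  then obtain i where i: "i \<in> indices S \<omega>" "snd S i \<omega> \<in> square r_p s"
    and sees: "sees_opportunity R_I r_I net \<omega> (snd S i \<omega>)"
    unfolding occupied_def points_def by blast
  define x where "x = snd S i \<omega>"
  \<comment> \<open>The \<open>3\<close> again collects the displacement of \<open>c\<close> and the
    two enlargements, so \<open>J\<close> contains every transmitter that could block from
    \<open>c\<close>.\<close>
  define J where "J = {j \<in> indices T \<omega>. snd T j \<omega> \<in> cball x (R_I + r_I + R_p + 3)}"
  \<comment> \<open>The margins by which these transmitters and their receivers avoid the exclusion
    disks; the \<open>1\<close> keeps \<open>W\<close> nonempty, so that \<open>Min W\<close> is
    meaningful.\<close>
  define W where "W = insert 1 ((\<lambda>j. dist x (snd T j \<omega>) - R_I) ` J \<union> (\<lambda>j. dist x (rx net j \<omega>) - r_I) ` J)"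
  have "finite J" unfolding J_def by (rule fin) simp
  then have "finite W" by (simp add: W_def)
  moreover have "\<forall>w\<in>W. 0 < w"
    using sees by (auto simp: W_def J_def x_def[symmetric] sees_opportunity_def)
  ultimately have W: "0 < Min W" by (subst Min_gr_iff) (auto simp: W_def)
  \<comment> \<open>Half the margin, because \<open>1 / Suc k\<close> is spent twice: on the
    distance from \<open>x\<close> to \<open>c\<close> and on the enlarged radius.\<close>
  obtain k where k: "1 / real (Suc k) < Min W / 2"
    using W nat_approx_posE[of "Min W / 2"] by auto
  have k0: "0 < 1 / real (Suc k)" "1 / real (Suc k) \<le> 1" by auto
  obtain c where c: "c \<in> D" "dist x c < 1 / Suc k"
    using D[of "ball x (1 / Suc k)"] k0 by auto
  have "marked_void net (blocking (R_I + 1 / Suc k) (r_I + 1 / Suc k) c) \<omega>"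
    unfolding marked_void_def
  proof (intro ballI notI)
    fix j assume j: "j \<in> indices T \<omega>" "(snd T j \<omega>, rx_offset net j \<omega>) \<in> blocking (R_I + 1 / Suc k) (r_I + 1 / Suc k) c"
    have tri: "dist x t \<le> dist c t + 1 / Suc k" for t
      using dist_triangle[of x t c] c(2) by linarith
    have "dist c (snd T j \<omega>) \<le> (R_I + 1 / Suc k) + (r_I + 1 / Suc k) + R_p"
      by (rule blocking_near[OF _ _ j(2)]) (use R in auto)
    then have "dist x (snd T j \<omega>) \<le> R_I + r_I + R_p + 3"
      using tri[of "snd T j \<omega>"] k0 by linarith
    then have "j \<in> J" using j(1) by (simp add: J_def)
    then have "dist x (snd T j \<omega>) - R_I \<in> W" "dist x (rx net j \<omega>) - r_I \<in> W"
      by (auto simp: W_def)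
    then have "Min W \<le> dist x (snd T j \<omega>) - R_I" "Min W \<le> dist x (rx net j \<omega>) - r_I"
      using \<open>finite W\<close> by (auto intro: Min_le)
    moreover have "dist c (snd T j \<omega>) \<le> R_I + 1 / Suc k \<or> dist c (rx net j \<omega>) \<le> r_I + 1 / Suc k"
      using j(2) by (simp add: blocking_def rx_offset_def)
    ultimately show False
      using tri[of "snd T j \<omega>"] tri[of "rx net j \<omega>"] k by linarith
  qed
  moreover have "\<not> void S (square r_p s \<inter> ball c (1 / Suc k)) \<omega>"
    using i c(2) unfolding void_def x_def by (auto simp: dist_commute)
  ultimately show "approx_occupied R_I r_p r_I D \<omega> s"
    using c(1) unfolding approx_occupied_def by blast
qed

lemma infinite_component_zero_one:
  assumes R: "0 < R_I" "0 < r_I" and r_p: "0 < r_p"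
  shows "(AE \<omega> in M. \<exists>s. in_infinite_component {s. occupied R_I r_p r_I net \<omega> s} (neighbors r_p) s) \<or>
    (AE \<omega> in M. \<not> (\<exists>s. in_infinite_component {s. occupied R_I r_p r_I net \<omega> s} (neighbors r_p) s))"
proof -
  interpret prob_space M by (rule prob_space_M)
  obtain D :: "plane set" where D: "countable D" "\<And>X. open X \<Longrightarrow> X \<noteq> {} \<Longrightarrow> \<exists>d\<in>D. d \<in> X"
    using countable_dense_exists by blast
  define V where "V \<omega> = {s. approx_occupied R_I r_p r_I D \<omega> s}" for \<omega>
  define perc where "perc \<omega> \<longleftrightarrow> (\<exists>s. in_infinite_component (V \<omega>) (neighbors r_p) s)" for \<omega>
  have tail: "{\<omega>\<in>space M. perc \<omega>} \<in> sets (tail_algebra n)" for n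
  proof -
    define B where "B = {s. \<exists>x\<in>square r_p s. norm x < real n + (R_I + r_I + R_p + 3)}"
    have B: "finite B" unfolding B_def by (rule finite_squares_meeting_ball[OF r_p])
    \<comment> \<open>Only the finitely many sites of \<open>B\<close> may involve points of norm
      below \<open>n\<close>, and deleting them does not affect \<open>perc\<close>; this works for
      every \<open>n\<close>.\<close>
    have eq: "perc \<omega> \<longleftrightarrow> (\<exists>s. in_infinite_component (V \<omega> - B) (neighbors r_p) s)" for \<omega>
      using infinite_component_remove_finite[where E="neighbors r_p", OF _ B finite_neighbors[OF r_p]]
        in_infinite_component_mono[of "V \<omega> - B" _ _ "V \<omega>"]
      unfolding perc_def by blast
    have "Measurable.pred (tail_algebra n) (\<lambda>\<omega>. s \<in> V \<omega> - B)" for s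
    proof (cases "s \<in> B")
      case False
      then have "real n + (R_I + r_I + R_p + 3) \<le> norm x" if "x \<in> square r_p s" for x
        using that unfolding B_def by force
      from pred_tail_approx_occupied[OF R D(1) this] False show ?thesis
        by (simp add: V_def)
    qed simp
    then have "Measurable.pred (tail_algebra n) (\<lambda>\<omega>. in_infinite_component (V \<omega> - B) (neighbors r_p) s)" for s
      by (rule pred_in_infinite_component)
    then have "Measurable.pred (tail_algebra n) perc"
      unfolding eq by measurable
    then show ?thesis by (simp add: pred_def space_tail_algebra)
  qed
  have "prob {\<omega>\<in>space M. perc \<omega>} = 0 \<or> prob {\<omega>\<in>space M. perc \<omega>} = 1"
  proof (rule kolmogorov_0_1_law)
    show "sigma_algebra (space M) (sigma_sets (space M) (void_family n))" for n
      by (rule sigma_algebra_sigma_sets) (auto simp: void_family_def)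
    show "indep_sets (\<lambda>n. sigma_sets (space M) (void_family n)) UNIV"
      by (rule indep_sets_sigma[OF indep_void_family Int_stable_void_family])
    show "{\<omega>\<in>space M. perc \<omega>} \<in> tail_events (\<lambda>n. sigma_sets (space M) (void_family n))"
      using tail unfolding tail_events_def sets_tail_algebra by blast
  qed
  moreover have events: "{\<omega>\<in>space M. perc \<omega>} \<in> events"
  proof -
    have "sigma_sets (space M) (\<Union>m\<in>{0..}. sigma_sets (space M) (void_family m)) \<subseteq> events"
      using void_family_events by (intro sets.sigma_sets_subset UN_least) auto
    then show ?thesis using tail[of 0] unfolding sets_tail_algebra by blast
  qed
  ultimately have "(AE \<omega> in M. perc \<omega>) \<or> (AE \<omega> in M. \<not> perc \<omega>)"
    using prob_Collect_eq_0[of perc] prob_Collect_eq_1[of perc] by blast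
  \<comment> \<open>The law has been applied to the approximation \<open>V\<close>; off a null set
    it is the true set of occupied sites.\<close>
  moreover have "AE \<omega> in M. V \<omega> = {s. occupied R_I r_p r_I net \<omega> s}"
    using AE_network
  proof eventually_elim
    case (elim \<omega>)
    then show ?case
      unfolding V_def by (intro Collect_cong occupied_iff_approx[OF R D(2), symmetric]) auto
  qed
  ultimately show ?thesis
  proof (elim disjE)
    assume "AE \<omega> in M. perc \<omega>" "AE \<omega> in M. V \<omega> = {s. occupied R_I r_p r_I net \<omega> s}"
    then have "AE \<omega> in M. \<exists>s. in_infinite_component {s. occupied R_I r_p r_I net \<omega> s} (neighbors r_p) s"
      by eventually_elim (simp add: perc_def)
    then show ?thesis ..
  next
    assume "AE \<omega> in M. \<not> perc \<omega>" "AE \<omega> in M. V \<omega> = {s. occupied R_I r_p r_I net \<omega> s}"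
    then have "AE \<omega> in M. \<not> (\<exists>s. in_infinite_component {s. occupied R_I r_p r_I net \<omega> s} (neighbors r_p) s)"
      by eventually_elim (simp add: perc_def)
    then show ?thesis ..
  qed
qed

end

section \<open>From sites to secondary users\<close>

text \<open>The side length is made for this: a detour through a common point \<open>z\<close> costs
  at most two diameters \<open>sqrt 2 * d\<close>, together exactly \<open>r_p\<close>.\<close>

lemma dist_adjacent_squares:
  assumes r_p: "0 < r_p" and x: "x \<in> square r_p s" and y: "y \<in> square r_p t" and st: "s = t \<or> neighbors r_p s t"
  shows "dist x y \<le> r_p"
proof -
  define d where "d = side_length r_p"
  have d: "0 < d" "2 * (sqrt 2 * d) = r_p" using r_p by (auto simp: d_def side_length_def)
  have diam: "dist a b \<le> sqrt 2 * d" if "a \<in> square r_p u" "b \<in> square r_p u" for a b u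
  proof -
    have "\<bar>(a - b) $ k\<bar> \<le> d" for k
    proof -
      have "\<bar>a $ k - site_center r_p u $ k\<bar> \<le> d / 2" "\<bar>b $ k - site_center r_p u $ k\<bar> \<le> d / 2"
        using that by (auto simp: square_def d_def)
      then show ?thesis unfolding vector_minus_component by linarith
    qed
    then have "((a - b) $ k)\<^sup>2 \<le> d\<^sup>2" for k
      using power_mono[of "\<bar>(a - b) $ k\<bar>" d 2] by simp
    then have "(\<Sum>k\<in>UNIV. ((a - b) $ k)\<^sup>2) \<le> 2 * d\<^sup>2"
      using sum_mono[of "UNIV :: 2 set" "\<lambda>k. ((a - b) $ k)\<^sup>2" "\<lambda>_. d\<^sup>2"] by simp
    then have "sqrt (\<Sum>k\<in>UNIV. ((a - b) $ k)\<^sup>2) \<le> sqrt (2 * d\<^sup>2)"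
      by (rule real_sqrt_le_mono)
    then show ?thesis
      using d by (simp add: dist_norm norm_vec_def L2_set_def real_sqrt_mult)
  qed
  obtain z where "z \<in> square r_p s" "z \<in> square r_p t"
    using st x by (auto simp: neighbors_def)
  then have "dist x z \<le> sqrt 2 * d" "dist z y \<le> sqrt 2 * d"
    using x y diam by blast+
  then show ?thesis using dist_triangle[of x y z] d by linarith
qed

text \<open>Each occupied square is represented by one user \<open>f s\<close> that sees an
  opportunity. As squares are closed, a user may represent several of them, but only finitely many,
  so infinitely many sites yield infinitely many users.\<close>

lemma infinite_secondary_component:
  assumes r_p: "0 < r_p"
    and s0: "in_infinite_component {s. occupied R_I r_p r_I net \<omega> s} (neighbors r_p) s0"
  shows "\<exists>x. in_infinite_component (points (secondary net) \<omega>) (secondary_edge R_I r_p r_I net \<omega>) x"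
proof -
  let ?occ = "\<lambda>s. occupied R_I r_p r_I net \<omega> s"
  let ?C = "{t. (\<lambda>a b. a \<in> {s. ?occ s} \<and> b \<in> {s. ?occ s} \<and> neighbors r_p a b)\<^sup>*\<^sup>* s0 t}"
  let ?V = "points (secondary net) \<omega>"
  let ?R = "(\<lambda>a b. a \<in> ?V \<and> b \<in> ?V \<and> secondary_edge R_I r_p r_I net \<omega> a b)\<^sup>*\<^sup>*"
  have "\<exists>f. \<forall>s. ?occ s \<longrightarrow> f s \<in> ?V \<and> f s \<in> square r_p s \<and> sees_opportunity R_I r_I net \<omega> (f s)"
    unfolding occupied_def by (intro choice) blast
  then obtain f where f: "\<And>s. ?occ s \<Longrightarrow> f s \<in> ?V" "\<And>s. ?occ s \<Longrightarrow> f s \<in> square r_p s"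
      "\<And>s. ?occ s \<Longrightarrow> sees_opportunity R_I r_I net \<omega> (f s)"
    by blast
  have occ0: "?occ s0" and inf: "infinite ?C"
    using s0 unfolding in_infinite_component_def by auto
  have path: "?occ t \<and> ?R (f s0) (f t)" if "t \<in> ?C" for t
    using that unfolding mem_Collect_eq
  proof (induction rule: rtranclp_induct)
    case base
    then show ?case using occ0 by simp
  next
    case (step t u)
    then have "dist (f t) (f u) \<le> r_p"
      using dist_adjacent_squares[OF r_p f(2) f(2)] by blast
    \<comment> \<open>Equality is possible when one user on the common boundary represents both
      squares, and \<open>secondary_edge\<close> excludes loops.\<close>
    then have "f t = f u \<or> secondary_edge R_I r_p r_I net \<omega> (f t) (f u)"
      using step f(3) unfolding secondary_edge_def by blast
    moreover have "f t \<in> ?V" "f u \<in> ?V" using step f(1) by blast+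
    ultimately have "?R (f t) (f u)" by (metis (no_types, lifting) r_into_rtranclp rtranclp.rtrancl_refl)
    then show ?case using step by (blast intro: rtranclp_trans)
  qed
  have "infinite (f ` ?C)"
  proof
    assume "finite (f ` ?C)"
    then have "finite (\<Union>y\<in>f ` ?C. {s. y \<in> square r_p s})"
      using finite_squares_containing[OF r_p] by blast
    moreover have "?C \<subseteq> (\<Union>y\<in>f ` ?C. {s. y \<in> square r_p s})"
      using path f(2) by blast
    ultimately show False using inf finite_subset by blast
  qed
  moreover have "f ` ?C \<subseteq> {y. ?R (f s0) y}" using path by blast
  ultimately have "infinite {y. ?R (f s0) y}" using finite_subset by blast
  then show ?thesis
    using f(1)[OF occ0] unfolding in_infinite_component_def by blast
qed

theorem theorem4:
  fixes net :: "'w network" and R_p R_I r_p r_I l_S l_PT :: real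
  assumes "R_p > 0" and "R_I > 0" and "r_p > 0" and "r_I > 0"
    and "l_S > 0" and "l_PT \<ge> 0"
    and "heterogeneous_network R_p l_S l_PT net"
    and "(1 - exp (- (l_S * r_p\<^sup>2 / 8))) *
           exp (- (l_PT * (pi * (R_I\<^sup>2 + r_I\<^sup>2 - overlap_integral R_I R_p r_I))))
         > upper_critical_prob TYPE('w) R_p R_I r_p r_I"
  shows "secondary_network_connected R_I r_p r_I net"
proof -
  interpret network_model net R_p l_S l_PT
    using assms by unfold_locales auto
  let ?inf = "\<lambda>\<omega> s. in_infinite_component {s. occupied R_I r_p r_I net \<omega> s} (neighbors r_p) s"
  have "upper_critical_prob TYPE('w) R_p R_I r_p r_I < occupied_prob R_I r_p r_I net"
    using assms occupied_prob_lower_bound[of R_I r_I r_p] by linarith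
  then have "origin_percolates R_I r_p r_I net"
    using upper_critical_prob_minimum(1)[of "TYPE('w)" R_p R_I r_p r_I] assms
    unfolding percolation_thresholds_def by blast
  then have pos: "measure M {\<omega> \<in> space M. ?inf \<omega> (0, 0)} > 0"
    by (simp add: origin_percolates_def)
  \<comment> \<open>\<open>measure\<close> takes the value \<open>0\<close> on sets that are not
    measurable, so positivity yields measurability.\<close>
  then have sets: "{\<omega> \<in> space M. ?inf \<omega> (0, 0)} \<in> sets M"
    using measure_notin_sets by fastforce
  have "\<not> (AE \<omega> in M. \<not> (\<exists>s. ?inf \<omega> s))"
  proof
    assume "AE \<omega> in M. \<not> (\<exists>s. ?inf \<omega> s)"
    then have "AE \<omega> in M. \<not> ?inf \<omega> (0, 0)" by eventually_elim blast
    then have "emeasure M {\<omega> \<in> space M. ?inf \<omega> (0, 0)} = 0"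
      using sets by (subst (asm) AE_iff_measurable[OF _ refl]) auto
    then show False using pos by (simp add: measure_def)
  qed
  then have "AE \<omega> in M. \<exists>s. ?inf \<omega> s"
    using infinite_component_zero_one[OF assms(2,4,3)] by blast
  then show ?thesis
    unfolding secondary_network_connected_def
  proof eventually_elim
    case (elim \<omega>)
    then obtain s where "?inf \<omega> s" ..
    then show ?case by (rule infinite_secondary_component[OF assms(3)])
  qed
qed

end
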